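(* Let $H$ be a hypergroup. (a) Suppose that $UCB_r(H)$ has a left invariant mean. Then for every non-empty compact convex subset $K$ of a Hausdorff locally convex vector space and every jointly continuous affine action $\cdot : H\times K\to K$ of $H$ on $K$, there is a point $\xi_0\in K$ such that $x\cdot\xi_0=\xi_0$ for all $x\in H$. (b) Suppose that $WUCB_r(H)$ has a left invariant mean. Then for every non-empty compact convex subset $K$ of a Hausdorff locally convex vector space and every separately continuous affine action $\cdot : H\times K\to K$ of $H$ on $K$, there is a point $\xi_0\in K$ such that $x\cdot\xi_0=\xi_0$ for all $x\in H$.
   Context: Hypergroup: a non-empty locally compact Hausdorff space $H$ such that: (1) there is a binary operation $\ast$ (convolution) on the vector space $M(H)$ of bounded complex regular Borel (Radon) measures making it an algebra (as usual, convolution is determined by its values on point masses: $\mu\ast\nu=\int\int \delta_x\ast\delta_y\,d\mu(x)\,d\nu(y)$ weakly); (2) for $x,y\in H$, $\delta_x\ast\delta_y$ is a probability measure with compact support; (3) the map $(x,y)\mapsto\delta_x\ast\delta_y$ from $H\times H$ to the compactly supported probability measures is continuous (for the weak topology given by integration against bounded continuous functions); (4) the map $(x,y)\mapsto \mathrm{supp}(\delta_x\ast\delta_y)$ is continuous into the space of non-empty compact subsets of $H$ with the Michael topology (generated by the sets $\{C: C\cap U\neq\emptyset,\ C\subset V\}$, $U,V\subset H$ open); (5) there is a unique $e\in H$ with $\delta_x\ast\delta_e=\delta_e\ast\delta_x=\delta_x$ for all $x\in H$; (6) there is a homeomorphism $x\mapsto\check{x}$ of $H$ with $\check{\check{x}}=x$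 which, extended to $M(H)$ by $\check{\mu}(A)=\mu(\{x\in H:\check{x}\in A\})$, satisfies $(\mu\ast\nu)\check{}=\check{\nu}\ast\check{\mu}$; (7) for $x,y\in H$, $e\in\mathrm{supp}(\delta_x\ast\delta_y)$ if and only if $y=\check{x}$. $C(H)$ is the space of bounded continuous complex-valued functions on $H$ with the supremum norm. For $f\in C(H)$ and $x\in H$, the left translate is $(\delta_x\ast f)(y)=\int_H f\,d(\delta_{\check{x}}\ast\delta_y)$. $UCB_r(H)$ [respectively $WUCB_r(H)$] is the space of $f\in C(H)$ such that the map $H\ni x\mapsto\delta_x\ast f\in C(H)$ is continuous for the norm topology [respectively the weak topology $\sigma(C(H),C(H)^* )$] on $C(H)$. A left invariant mean on $X=UCB_r(H)$ or $WUCB_r(H)$ is a linear functional $m$ on $X$ with $\|m\|=m(1)=1$ and $m(\delta_x\ast f)=m(f)$ for all $f\in X$, $x\in H$. A separately [jointly] continuous action of $H$ on a compact convex subset $K$ of a Hausdorff locally convex space $E$ is a separately [jointly] continuous map $\cdot:H\times K\to K$ such that $e\cdot\xi=\xi$ for all $\xi\in K$, and $x\cdot(y\cdot\xi)=\int_H (t\cdot\xi)\,d(\delta_x\ast\delta_y)(t)$ for all $x,y\in H$, $\xi\in K$, where the right-hand side is the weak integral (the unique element $\eta\in K$ with $\phi(\eta)=\int_H\phi(t\cdot\xi)\,d(\delta_x\ast\delta_y)(t)$ for every continuous linear functional $\phi$ on $E$). The action is affine if $\xi\mapsto x\cdot\xi$ is affine for each $x\in H$. *)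

theory Defs
  imports "HOL-Probability.Probability"
begin

section \<open>Hausdorff locally convex spaces\<close>

text \<open>Convexity is written out in the class axiom, because \<^const>\<open>convex\<close> cannot be used on
  the type parameter of a class specification.\<close>

class hausdorff_lcs = real_vector + topological_ab_group_add + t2_space +
  assumes tendsto_scaleR_Pair:
      "LIM p (nhds c \<times>\<^sub>F nhds v). fst p *\<^sub>R snd p :> nhds (c *\<^sub>R v)"
    and locally_convex_raw:
      "open U \<Longrightarrow> 0 \<in> U \<Longrightarrow> \<exists>V. open V \<and> 0 \<in> V \<and> V \<subseteq> U \<and>
         (\<forall>x\<in>V. \<forall>y\<in>V. \<forall>u\<ge>0. \<forall>v\<ge>0. u + v = 1 \<longrightarrow> u *\<^sub>R x + v *\<^sub>R y \<in> V)"

lemma locally_convex: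
  fixes U :: "'v::hausdorff_lcs set"
  assumes "open U" "0 \<in> U"
  shows "\<exists>V. open V \<and> convex V \<and> 0 \<in> V \<and> V \<subseteq> U"
  using locally_convex_raw[OF assms] unfolding convex_def by meson

section \<open>Bounded complex regular Borel measures\<close>

text \<open>A complex Borel measure is a set function that is countably additive on the Borel sets;
  it takes the value 0 on non-Borel sets, so that equality of measures is equality of functions.\<close>

type_synonym 'h cmeasure = "'h set \<Rightarrow> complex"

definition complex_borel_measure :: "('h::topological_space) cmeasure \<Rightarrow> bool" where
  "complex_borel_measure \<mu> \<longleftrightarrow>
     (\<forall>A. A \<notin> sets borel \<longrightarrow> \<mu> A = 0) \<and> \<mu> {} = 0 \<and>
     (\<forall>A :: nat \<Rightarrow> 'h set. range A \<subseteq> sets borel \<longrightarrow> disjoint_family A \<longrightarrow>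
        (\<lambda>n. \<mu> (A n)) sums \<mu> (\<Union>n. A n))"

definition total_var :: "('h::topological_space) cmeasure \<Rightarrow> 'h set \<Rightarrow> ennreal" where
  "total_var \<mu> A =
     (SUP P \<in> {P. finite P \<and> disjoint P \<and> P \<subseteq> sets borel \<and> \<Union>P \<subseteq> A}.
        \<Sum>B\<in>P. ennreal (cmod (\<mu> B)))"

definition Meas :: "('h::topological_space) cmeasure set" where
  "Meas = {\<mu>. complex_borel_measure \<mu> \<and> total_var \<mu> UNIV < \<infinity> \<and>
     (\<forall>A\<in>sets borel.
        total_var \<mu> A = (INF U\<in>{U. open U \<and> A \<subseteq> U}. total_var \<mu> U) \<and>
        total_var \<mu> A = (SUP C\<in>{C. compact C \<and> C \<subseteq> A}. total_var \<mu> C))}"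

definition point_mass :: "'h::topological_space \<Rightarrow> 'h cmeasure" where
  "point_mass x = (\<lambda>A. if A \<in> sets borel then indicator A x else 0)"

text \<open>The positive part of the Jordan decomposition of a real measure \<open>\<nu>\<close>; negative values of
  \<open>\<nu>\<close> are truncated to 0 by \<^const>\<open>ennreal\<close>, which does not affect the supremum since the
  empty set contributes 0.\<close>

definition pos_variation :: "('h::topological_space set \<Rightarrow> real) \<Rightarrow> 'h measure" where
  "pos_variation \<nu> =
     measure_of UNIV (sets borel) (\<lambda>A. SUP B\<in>{B \<in> sets borel. B \<subseteq> A}. ennreal (\<nu> B))"

definition cintegral :: "('h::topological_space) cmeasure \<Rightarrow> ('h \<Rightarrow> complex) \<Rightarrow> complex" where
  "cintegral \<mu> f =
     ((LINT x|pos_variation (\<lambda>A. Re (\<mu> A)). f x) - (LINT x|pos_variation (\<lambda>A. - Re (\<mu> A)). f x))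
     + \<i> * ((LINT x|pos_variation (\<lambda>A. Im (\<mu> A)). f x) - (LINT x|pos_variation (\<lambda>A. - Im (\<mu> A)). f x))"

definition msupport :: "('h::topological_space) cmeasure \<Rightarrow> 'h set" where
  "msupport \<mu> = {x. \<forall>U. open U \<longrightarrow> x \<in> U \<longrightarrow> total_var \<mu> U \<noteq> 0}"

definition prob_compact :: "('h::topological_space) cmeasure set" where
  "prob_compact = {\<mu> \<in> Meas. (\<forall>A. Im (\<mu> A) = 0 \<and> 0 \<le> Re (\<mu> A)) \<and> \<mu> UNIV = 1 \<and>
     compact (msupport \<mu>)}"

definition weak_meas_topology :: "('h::topological_space) cmeasure topology" where
  "weak_meas_topology = topology_generated_by
     {{\<mu> \<in> Meas. cintegral \<mu> (apply_bcontfun f) \<in> U} | (f :: 'h \<Rightarrow>\<^sub>C complex) U. open U}"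

definition michael_topology :: "('h::topological_space) set topology" where
  "michael_topology = topology_generated_by
     {{C. compact C \<and> C \<noteq> {} \<and> C \<inter> U \<noteq> {} \<and> C \<subseteq> V} | U V. open U \<and> open V}"

section \<open>Hypergroups\<close>

text \<open>The convolution \<open>conv\<close> matters only on \<^const>\<open>Meas\<close>; \<open>invol\<close> is the involution.\<close>

locale hypergroup =
  fixes conv :: "('h::t2_space) cmeasure \<Rightarrow> 'h cmeasure \<Rightarrow> 'h cmeasure"
    and e :: 'h
    and invol :: "'h \<Rightarrow> 'h"
  assumes locally_compact: "locally_compact_space (euclidean :: 'h topology)"
    and conv_closed: "\<mu> \<in> Meas \<Longrightarrow> \<nu> \<in> Meas \<Longrightarrow> conv \<mu> \<nu> \<in> Meas"
    and conv_add_left: "\<mu> \<in> Meas \<Longrightarrow> \<mu>' \<in> Meas \<Longrightarrow> \<nu> \<in> Meas \<Longrightarrow>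
        conv (\<lambda>A. \<mu> A + \<mu>' A) \<nu> = (\<lambda>A. conv \<mu> \<nu> A + conv \<mu>' \<nu> A)"
    and conv_add_right: "\<mu> \<in> Meas \<Longrightarrow> \<nu> \<in> Meas \<Longrightarrow> \<nu>' \<in> Meas \<Longrightarrow>
        conv \<mu> (\<lambda>A. \<nu> A + \<nu>' A) = (\<lambda>A. conv \<mu> \<nu> A + conv \<mu> \<nu>' A)"
    and conv_scale_left: "\<mu> \<in> Meas \<Longrightarrow> \<nu> \<in> Meas \<Longrightarrow>
        conv (\<lambda>A. c * \<mu> A) \<nu> = (\<lambda>A. c * conv \<mu> \<nu> A)"
    and conv_scale_right: "\<mu> \<in> Meas \<Longrightarrow> \<nu> \<in> Meas \<Longrightarrow>
        conv \<mu> (\<lambda>A. c * \<nu> A) = (\<lambda>A. c * conv \<mu> \<nu> A)"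
    and conv_assoc: "\<mu> \<in> Meas \<Longrightarrow> \<nu> \<in> Meas \<Longrightarrow> \<rho> \<in> Meas \<Longrightarrow>
        conv (conv \<mu> \<nu>) \<rho> = conv \<mu> (conv \<nu> \<rho>)"
    and conv_weak: "\<mu> \<in> Meas \<Longrightarrow> \<nu> \<in> Meas \<Longrightarrow>
        cintegral (conv \<mu> \<nu>) (apply_bcontfun f) =
        cintegral \<nu> (\<lambda>y. cintegral \<mu> (\<lambda>x.
          cintegral (conv (point_mass x) (point_mass y)) (apply_bcontfun f)))"
    and conv_prob: "conv (point_mass x) (point_mass y) \<in> prob_compact"
    and conv_continuous:
        "continuous_map euclidean (subtopology weak_meas_topology prob_compact)
           (\<lambda>(x, y). conv (point_mass x) (point_mass y))"
    and msupport_continuous: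
        "continuous_map euclidean michael_topology
           (\<lambda>(x, y). msupport (conv (point_mass x) (point_mass y)))"
    and identity:
        "conv (point_mass x) (point_mass e) = point_mass x \<and>
         conv (point_mass e) (point_mass x) = point_mass x"
    and identity_unique:
        "(\<And>x. conv (point_mass x) (point_mass e') = point_mass x \<and>
               conv (point_mass e') (point_mass x) = point_mass x) \<Longrightarrow> e' = e"
    and invol_homeomorphism: "homeomorphism UNIV UNIV invol invol"
    and invol_invol: "invol (invol x) = x"
    and invol_conv: "\<mu> \<in> Meas \<Longrightarrow> \<nu> \<in> Meas \<Longrightarrow>
        (\<lambda>A. conv \<mu> \<nu> {x. invol x \<in> A}) =
        conv (\<lambda>A. \<nu> {x. invol x \<in> A}) (\<lambda>A. \<mu> {x. invol x \<in> A})"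
    and e_in_msupport:
        "e \<in> msupport (conv (point_mass x) (point_mass y)) \<longleftrightarrow> y = invol x"

section \<open>Translates, function spaces and means\<close>

text \<open>The function passed to \<^const>\<open>Bcontfun\<close> is bounded and continuous in every
  hypergroup; see the lemma \<open>left_translate_apply\<close> below.\<close>

definition left_translate ::
  "(('h::t2_space) cmeasure \<Rightarrow> 'h cmeasure \<Rightarrow> 'h cmeasure) \<Rightarrow> ('h \<Rightarrow> 'h) \<Rightarrow>
   'h \<Rightarrow> ('h \<Rightarrow>\<^sub>C complex) \<Rightarrow> ('h \<Rightarrow>\<^sub>C complex)" where
  "left_translate conv invol x f =
     Bcontfun (\<lambda>y. cintegral (conv (point_mass (invol x)) (point_mass y)) (apply_bcontfun f))"

lemma pos_variation_nonneg:
  fixes \<mu> :: "('h::topological_space) cmeasure"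
  assumes \<mu>: "complex_borel_measure \<mu>" and nonneg: "\<And>A. 0 \<le> Re (\<mu> A)"
  shows "space (pos_variation (\<lambda>A. Re (\<mu> A))) = UNIV"
    and "sets (pos_variation (\<lambda>A. Re (\<mu> A))) = sets borel"
    and "A \<in> sets borel \<Longrightarrow> emeasure (pos_variation (\<lambda>A. Re (\<mu> A))) A = ennreal (Re (\<mu> A))"
proof -
  let ?N = "pos_variation (\<lambda>A. Re (\<mu> A))"
  have sa: "sigma_algebra UNIV (sets (borel :: 'h measure))"
    by (metis sets.sigma_algebra_axioms space_borel)
  show sp: "space ?N = UNIV"
    by (simp add: pos_variation_def space_measure_of_conv)
  show st: "sets ?N = sets borel"
    unfolding pos_variation_def using sa
    by (simp add: sigma_algebra.sets_measure_of_eq sigma_algebra.sigma_sets_eq)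
  have sums: "(\<lambda>n. \<mu> (B n)) sums \<mu> (\<Union>n. B n)"
    if "range B \<subseteq> sets borel" "disjoint_family B" for B :: "nat \<Rightarrow> 'h set"
    using \<mu> that unfolding complex_borel_measure_def by blast
  have empty: "\<mu> {} = 0" using \<mu> unfolding complex_borel_measure_def by blast
  let ?\<nu> = "\<lambda>A. ennreal (Re (\<mu> A))"
  have pos: "positive (sets borel) ?\<nu>"
    by (simp add: positive_def empty)
  have ca: "countably_additive (sets borel) ?\<nu>"
  proof (rule countably_additiveI)
    fix B :: "nat \<Rightarrow> 'h set"
    assume B: "range B \<subseteq> sets borel" "disjoint_family B"
    have "(\<lambda>n. Re (\<mu> (B n))) sums Re (\<mu> (\<Union>n. B n))"
      by (rule sums_Re[OF sums[OF B]])
    then show "(\<Sum>n. ?\<nu> (B n)) = ?\<nu> (\<Union>n. B n)"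
      by (intro suminf_ennreal_eq nonneg)
  qed
  have mono: "?\<nu> B \<le> ?\<nu> A" if "A \<in> sets borel" "B \<in> sets borel" "B \<subseteq> A" for A B
  proof -
    have "emeasure (measure_of UNIV (sets borel) ?\<nu>) B \<le> emeasure (measure_of UNIV (sets borel) ?\<nu>) A"
      by (rule emeasure_mono) (use that sa in \<open>auto simp: sigma_algebra.sets_measure_of_eq sigma_algebra.sigma_sets_eq\<close>)
    then show ?thesis
      using that emeasure_measure_of_sigma[OF sa pos ca] by simp
  qed
  have eq: "(SUP B\<in>{B \<in> sets borel. B \<subseteq> A}. ?\<nu> B) = ?\<nu> A" if "A \<in> sets borel" for A
    by (rule antisym; intro SUP_least SUP_upper) (use that mono in auto)
  let ?S = "\<lambda>A. SUP B\<in>{B \<in> sets borel. B \<subseteq> A}. ?\<nu> B"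
  have pos': "positive (sets borel) ?S"
    unfolding positive_def using eq[of "{}"] by (simp add: empty)
  have ca': "countably_additive (sets borel) ?S"
  proof (rule countably_additiveI)
    fix B :: "nat \<Rightarrow> 'h set"
    assume B: "range B \<subseteq> sets borel" "disjoint_family B" "(\<Union>n. B n) \<in> sets borel"
    then have "\<And>n. ?S (B n) = ?\<nu> (B n)" "?S (\<Union>n. B n) = ?\<nu> (\<Union>n. B n)"
      using eq by blast+
    then show "(\<Sum>n. ?S (B n)) = ?S (\<Union>n. B n)"
      using ca B unfolding countably_additive_def by simp
  qed
  show "emeasure ?N A = ?\<nu> A" if "A \<in> sets borel"
    unfolding pos_variation_def
    using emeasure_measure_of_sigma[OF sa pos' ca' that] eq[OF that] by simp
qed

lemma pos_variation_nonpos: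
  assumes nonpos: "\<And>A. \<nu> A \<le> 0"
  shows "(LINT x|pos_variation \<nu>. f x) = (0 :: complex)"
proof -
  have "emeasure (pos_variation \<nu>) A = 0" for A
  proof -
    have "(SUP B\<in>{B \<in> sets borel. B \<subseteq> A}. ennreal (\<nu> B)) = 0" for A
      using nonpos by (simp add: ennreal_neg flip: bot_ennreal)
    then show ?thesis
      unfolding pos_variation_def
      by (metis (no_types, lifting) measure_of_of_measure emeasure_measure_of_conv)
  qed
  then have "AE x in pos_variation \<nu>. f x = 0"
    by (intro AE_I'[of "space (pos_variation \<nu>)"]) (auto simp: null_sets_def)
  then show ?thesis
    by (rule integral_eq_zero_AE)
qed

lemma cintegral_prob:
  assumes "\<mu> \<in> prob_compact"
  shows "cintegral \<mu> f = (LINT x|pos_variation (\<lambda>A. Re (\<mu> A)). f x)"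
    and "prob_space (pos_variation (\<lambda>A. Re (\<mu> A)))"
proof -
  have a: "complex_borel_measure \<mu>" "\<And>A. Im (\<mu> A) = 0" "\<And>A. 0 \<le> Re (\<mu> A)" "\<mu> UNIV = 1"
    using assms unfolding prob_compact_def Meas_def by auto
  show "cintegral \<mu> f = (LINT x|pos_variation (\<lambda>A. Re (\<mu> A)). f x)"
    unfolding cintegral_def using a by (simp add: pos_variation_nonpos)
  show "prob_space (pos_variation (\<lambda>A. Re (\<mu> A)))"
    by (rule prob_spaceI) (use pos_variation_nonneg[OF a(1,3)] a(4) in simp)
qed

lemma cmod_cintegral_prob_le:
  assumes "\<mu> \<in> prob_compact"
  shows "cmod (cintegral \<mu> (apply_bcontfun f)) \<le> norm f"
proof -
  let ?N = "pos_variation (\<lambda>A. Re (\<mu> A))"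
  have a: "complex_borel_measure \<mu>" "\<And>A. 0 \<le> Re (\<mu> A)"
    using assms unfolding prob_compact_def Meas_def by auto
  interpret N: prob_space ?N by (rule cintegral_prob[OF assms])
  have "apply_bcontfun f \<in> borel_measurable borel"
    by (rule borel_measurable_continuous_onI) simp
  then have "apply_bcontfun f \<in> borel_measurable ?N"
    using measurable_cong_sets[OF pos_variation_nonneg(2)[OF a] refl] by blast
  then have int: "integrable ?N (apply_bcontfun f)"
    by (rule N.integrable_const_bound[rotated, where B = "norm f"]) (auto simp: norm_bounded)
  have "cmod (LINT x|?N. apply_bcontfun f x) \<le> (LINT x|?N. cmod (apply_bcontfun f x))"
    by (rule integral_norm_bound)
  also have "\<dots> \<le> (LINT x|?N. norm f)"
    by (rule integral_mono) (use int in \<open>auto simp: norm_bounded\<close>)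
  also have "\<dots> = norm f" by (simp add: N.prob_space)
  finally show ?thesis using cintegral_prob(1)[OF assms] by simp
qed

lemma (in hypergroup) left_translate_apply:
  "apply_bcontfun (left_translate conv invol x f) y =
   cintegral (conv (point_mass (invol x)) (point_mass y)) (apply_bcontfun f)"
proof -
  let ?g = "\<lambda>y. cintegral (conv (point_mass (invol x)) (point_mass y)) (apply_bcontfun f)"
  have "open (?g -` U)" if "open U" for U
  proof -
    have "openin weak_meas_topology {\<mu> \<in> Meas. cintegral \<mu> (apply_bcontfun f) \<in> U}"
      unfolding weak_meas_topology_def by (rule topology_generated_by_Basis) (use that in blast)
    moreover have "continuous_map euclidean weak_meas_topology
        (\<lambda>y. conv (point_mass (invol x)) (point_mass y))"
    proof -
      have "continuous_map euclidean euclidean (\<lambda>y. (invol x, y))"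
        by (simp add: continuous_on_Pair)
      from continuous_map_compose[OF this conv_continuous] show ?thesis
        by (simp add: o_def continuous_map_in_subtopology)
    qed
    ultimately have "openin euclidean
        {y \<in> topspace euclidean. conv (point_mass (invol x)) (point_mass y)
           \<in> {\<mu> \<in> Meas. cintegral \<mu> (apply_bcontfun f) \<in> U}}"
      unfolding continuous_map_def by blast
    moreover have "conv (point_mass (invol x)) (point_mass y) \<in> Meas" for y
      using conv_prob[of "invol x" y] unfolding prob_compact_def by blast
    ultimately show ?thesis by (simp add: vimage_def)
  qed
  then have "continuous_on UNIV ?g" by (simp add: continuous_on_open_vimage)
  moreover have "bounded (range ?g)"
    unfolding bounded_iff using cmod_cintegral_prob_le[OF conv_prob] by blast
  ultimately have "?g \<in> bcontfun" by (simp add: bcontfun_def)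
  then show ?thesis unfolding left_translate_def by (simp add: Bcontfun_inverse)
qed

text \<open>The type of bounded continuous functions is only a real vector space in the library.\<close>

definition cscale :: "complex \<Rightarrow> ('h::topological_space \<Rightarrow>\<^sub>C complex) \<Rightarrow> ('h \<Rightarrow>\<^sub>C complex)" where
  "cscale c f = Bcontfun (\<lambda>x. c * apply_bcontfun f x)"

lemma cscale_apply: "apply_bcontfun (cscale c f) x = c * apply_bcontfun f x"
proof -
  have "(\<lambda>x. c * apply_bcontfun f x) \<in> bcontfun"
    using bounded_linear_image[OF bounded_apply_bcontfun[of f] bounded_linear_mult_right[of c]]
    by (auto simp: bcontfun_def image_image intro!: continuous_intros)
  then show ?thesis
    by (simp add: cscale_def Bcontfun_inverse)
qed

definition complex_linear_on ::
  "('h::topological_space \<Rightarrow>\<^sub>C complex) set \<Rightarrow> (('h \<Rightarrow>\<^sub>C complex) \<Rightarrow> complex) \<Rightarrow> bool" where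
  "complex_linear_on X L \<longleftrightarrow>
     (\<forall>f\<in>X. \<forall>g\<in>X. L (f + g) = L f + L g) \<and> (\<forall>c. \<forall>f\<in>X. L (cscale c f) = c * L f)"

definition weak_topology :: "('h::topological_space \<Rightarrow>\<^sub>C complex) topology" where
  "weak_topology = topology_generated_by
     {L -` U | L U. complex_linear_on UNIV L \<and> continuous_on UNIV L \<and> open U}"

definition UCBr ::
  "(('h::t2_space) cmeasure \<Rightarrow> 'h cmeasure \<Rightarrow> 'h cmeasure) \<Rightarrow> ('h \<Rightarrow> 'h) \<Rightarrow> ('h \<Rightarrow>\<^sub>C complex) set" where
  "UCBr conv invol = {f. continuous_on UNIV (\<lambda>x. left_translate conv invol x f)}"

definition WUCBr ::
  "(('h::t2_space) cmeasure \<Rightarrow> 'h cmeasure \<Rightarrow> 'h cmeasure) \<Rightarrow> ('h \<Rightarrow> 'h) \<Rightarrow> ('h \<Rightarrow>\<^sub>C complex) set" where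
  "WUCBr conv invol =
     {f. continuous_map euclidean weak_topology (\<lambda>x. left_translate conv invol x f)}"

definition left_invariant_mean ::
  "(('h::t2_space) cmeasure \<Rightarrow> 'h cmeasure \<Rightarrow> 'h cmeasure) \<Rightarrow> ('h \<Rightarrow> 'h) \<Rightarrow>
   ('h \<Rightarrow>\<^sub>C complex) set \<Rightarrow> (('h \<Rightarrow>\<^sub>C complex) \<Rightarrow> complex) \<Rightarrow> bool" where
  "left_invariant_mean conv invol X m \<longleftrightarrow>
     complex_linear_on X m \<and>
     (SUP f\<in>{f\<in>X. norm f \<le> 1}. ennreal (cmod (m f))) = 1 \<and>
     m (const_bcontfun 1) = 1 \<and>
     (\<forall>f\<in>X. \<forall>x. m (left_translate conv invol x f) = m f)"

section \<open>Actions on compact convex sets\<close>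

text \<open>\<open>weak_integral_in K \<mu> g \<eta>\<close>: the weak integral of the \<open>K\<close>-valued function \<open>g\<close> against
  \<open>\<mu>\<close> is \<open>\<eta>\<close>. Such an \<open>\<eta>\<close> is unique, as continuous functionals separate the points of a
  Hausdorff locally convex space.\<close>

definition weak_integral_in ::
  "'v::hausdorff_lcs set \<Rightarrow> ('h::topological_space) cmeasure \<Rightarrow> ('h \<Rightarrow> 'v) \<Rightarrow> 'v \<Rightarrow> bool" where
  "weak_integral_in K \<mu> g \<eta> \<longleftrightarrow> \<eta> \<in> K \<and>
     (\<forall>\<phi> :: 'v \<Rightarrow> real. linear \<phi> \<longrightarrow> continuous_on UNIV \<phi> \<longrightarrow>
        complex_of_real (\<phi> \<eta>) = cintegral \<mu> (\<lambda>t. complex_of_real (\<phi> (g t))))"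

definition hypergroup_action ::
  "(('h::t2_space) cmeasure \<Rightarrow> 'h cmeasure \<Rightarrow> 'h cmeasure) \<Rightarrow> 'h \<Rightarrow>
   'v::hausdorff_lcs set \<Rightarrow> ('h \<Rightarrow> 'v \<Rightarrow> 'v) \<Rightarrow> bool" where
  "hypergroup_action conv e K act \<longleftrightarrow>
     (\<forall>x. \<forall>\<xi>\<in>K. act x \<xi> \<in> K) \<and>
     (\<forall>\<xi>\<in>K. act e \<xi> = \<xi>) \<and>
     (\<forall>x y. \<forall>\<xi>\<in>K. weak_integral_in K (conv (point_mass x) (point_mass y))
        (\<lambda>t. act t \<xi>) (act x (act y \<xi>)))"

definition jointly_continuous_action ::
  "(('h::t2_space) cmeasure \<Rightarrow> 'h cmeasure \<Rightarrow> 'h cmeasure) \<Rightarrow> 'h \<Rightarrow>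
   'v::hausdorff_lcs set \<Rightarrow> ('h \<Rightarrow> 'v \<Rightarrow> 'v) \<Rightarrow> bool" where
  "jointly_continuous_action conv e K act \<longleftrightarrow>
     hypergroup_action conv e K act \<and> continuous_on (UNIV \<times> K) (\<lambda>(x, \<xi>). act x \<xi>)"

definition separately_continuous_action ::
  "(('h::t2_space) cmeasure \<Rightarrow> 'h cmeasure \<Rightarrow> 'h cmeasure) \<Rightarrow> 'h \<Rightarrow>
   'v::hausdorff_lcs set \<Rightarrow> ('h \<Rightarrow> 'v \<Rightarrow> 'v) \<Rightarrow> bool" where
  "separately_continuous_action conv e K act \<longleftrightarrow>
     hypergroup_action conv e K act \<and>
     (\<forall>x. continuous_on K (act x)) \<and> (\<forall>\<xi>\<in>K. continuous_on UNIV (\<lambda>x. act x \<xi>))"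

definition affine_action :: "'v::real_vector set \<Rightarrow> ('h \<Rightarrow> 'v \<Rightarrow> 'v) \<Rightarrow> bool" where
  "affine_action K act \<longleftrightarrow>
     (\<forall>x. \<forall>\<xi>\<in>K. \<forall>\<eta>\<in>K. \<forall>t\<in>{0..1}.
        act x ((1 - t) *\<^sub>R \<xi> + t *\<^sub>R \<eta>) = (1 - t) *\<^sub>R act x \<xi> + t *\<^sub>R act x \<eta>)"

end

theory Submission
  imports Defs
begin

text \<open>Fix \<open>\<xi> \<in> K\<close> and send an affine continuous \<open>h : K \<rightarrow> \<real>\<close> to the function \<open>y \<mapsto> h (y \<cdot> \<xi>)\<close> on
  \<open>H\<close>. Its left translate by \<open>x\<close> is the function of \<open>k \<mapsto> h (invol x \<cdot> k)\<close>, and it lies in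
  \<open>UCBr\<close> or \<open>WUCBr\<close> according to the continuity of the action. A functional on the affine
  continuous functions bounded by the supremum norm is \<open>a \<delta>\<^sub>p - (1 - a) \<delta>\<^sub>q\<close> for some \<open>p, q \<in> K\<close>,
  and is evaluation at a point if it maps 1 to 1. So a mean yields a point of \<open>K\<close>; invariance
  gives \<open>\<phi> (x \<cdot> p) = \<phi> p\<close> for all continuous linear \<open>\<phi>\<close>, and these separate points.\<close>

section \<open>Separation of points by continuous linear functionals\<close>

definition sublinear :: "('v::real_vector \<Rightarrow> real) \<Rightarrow> bool" where
  "sublinear p \<longleftrightarrow> (\<forall>x y. p (x + y) \<le> p x + p y) \<and> (\<forall>c\<ge>0. \<forall>x. p (c *\<^sub>R x) = c * p x)"

lemma sublinear_add: "sublinear p \<Longrightarrow> p (x + y) \<le> p x + p y"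
  and sublinear_scale: "sublinear p \<Longrightarrow> c \<ge> 0 \<Longrightarrow> p (c *\<^sub>R x) = c * p x"
  by (auto simp: sublinear_def)

lemma sublinear_zero: "sublinear p \<Longrightarrow> p 0 = 0"
  using sublinear_scale[of p 0 0] by simp

lemma sublinear_minus_ge: "sublinear p \<Longrightarrow> - p (- x) \<le> p x"
  using sublinear_add[of p x "- x"] sublinear_zero[of p] by simp

text \<open>Applying the scaling inequality to the factor \<open>1 / c\<close> yields the reverse
  inequality for \<open>c\<close>, so one direction suffices.\<close>

lemma sublinearI:
  assumes add: "\<And>x y. p (x + y) \<le> p x + p y"
    and scale: "\<And>c x. c > 0 \<Longrightarrow> p (c *\<^sub>R x) \<le> c * p x" and zero: "p 0 = 0"
  shows "sublinear p"
  unfolding sublinear_def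
proof (intro conjI allI impI add)
  fix c :: real and x assume c: "0 \<le> c"
  show "p (c *\<^sub>R x) = c * p x"
  proof (cases "c = 0")
    case False
    with c have c: "c > 0" by simp
    have "p x = p ((1 / c) *\<^sub>R (c *\<^sub>R x))" using c by simp
    also have "\<dots> \<le> 1 / c * p (c *\<^sub>R x)" by (rule scale) (use c in simp)
    finally have "c * p x \<le> p (c *\<^sub>R x)" using c by (simp add: field_simps)
    with scale[OF c, of x] show ?thesis by simp
  qed (simp add: zero)
qed

text \<open>The largest sublinear functional below \<open>p\<close> whose value at \<open>- y\<close> is at most \<open>- p y\<close>.
  Hence a minimal sublinear functional is additive.\<close>

definition push_down :: "('v::real_vector \<Rightarrow> real) \<Rightarrow> 'v \<Rightarrow> 'v \<Rightarrow> real" where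
  "push_down p y x = (INF t\<in>{0..}. p (x + t *\<^sub>R y) - t * p y)"

text \<open>A real infimum is a lower bound only for sets bounded below. Here
  \<open>- p (- x)\<close> is such a bound, because \<open>t * p y\<close> is the value of
  \<open>p\<close> at the sum of \<open>x + t *\<^sub>R y\<close> and \<open>- x\<close>.\<close>

lemma push_down_le:
  assumes p: "sublinear p" and t: "t \<ge> 0"
  shows "push_down p y x \<le> p (x + t *\<^sub>R y) - t * p y"
  unfolding push_down_def
proof (rule cINF_lower)
  show "bdd_below ((\<lambda>t. p (x + t *\<^sub>R y) - t * p y) ` {0..})"
  proof (rule bdd_belowI2[where m = "- p (- x)"])
    fix t :: real assume t: "t \<in> {0..}"
    have "t * p y = p ((x + t *\<^sub>R y) + - x)" using sublinear_scale[OF p, of t y] t by simp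
    also have "\<dots> \<le> p (x + t *\<^sub>R y) + p (- x)" by (rule sublinear_add[OF p])
    finally show "- p (- x) \<le> p (x + t *\<^sub>R y) - t * p y" by simp
  qed
qed (use t in simp)

lemma push_down_ge:
  "(\<And>t. t \<ge> 0 \<Longrightarrow> b \<le> p (x + t *\<^sub>R y) - t * p y) \<Longrightarrow> b \<le> push_down p y x"
  unfolding push_down_def by (rule cINF_greatest) auto

text \<open>Parameters \<open>s\<close> for \<open>u\<close> and \<open>t\<close> for
  \<open>v\<close> combine to \<open>s + t\<close> for \<open>u + v\<close>, and the two infima are
  taken one after the other. Scaling by \<open>c\<close> turns the parameter \<open>t\<close> into
  \<open>c * t\<close>.\<close>

lemma sublinear_push_down:
  assumes p: "sublinear p"
  shows "sublinear (push_down p y)"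
proof (rule sublinearI)
  fix u v
  have "push_down p y (u + v) - (p (v + t *\<^sub>R y) - t * p y) \<le> push_down p y u" if t: "t \<ge> 0" for t
  proof (rule push_down_ge)
    fix s :: real assume s: "s \<ge> 0"
    have "push_down p y (u + v) \<le> p ((u + v) + (s + t) *\<^sub>R y) - (s + t) * p y"
      by (rule push_down_le[OF p]) (use s t in simp)
    also have "(u + v) + (s + t) *\<^sub>R y = (u + s *\<^sub>R y) + (v + t *\<^sub>R y)"
      by (simp add: algebra_simps)
    also have "p \<dots> \<le> p (u + s *\<^sub>R y) + p (v + t *\<^sub>R y)" by (rule sublinear_add[OF p])
    finally show "push_down p y (u + v) - (p (v + t *\<^sub>R y) - t * p y) \<le> p (u + s *\<^sub>R y) - s * p y"
      by (simp add: algebra_simps)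
  qed
  then have "push_down p y (u + v) - push_down p y u \<le> push_down p y v"
    by (intro push_down_ge) (simp add: algebra_simps)
  then show "push_down p y (u + v) \<le> push_down p y u + push_down p y v" by simp
next
  fix c :: real and x assume c: "c > 0"
  have "push_down p y (c *\<^sub>R x) / c \<le> push_down p y x"
  proof (rule push_down_ge)
    fix t :: real assume t: "t \<ge> 0"
    have "push_down p y (c *\<^sub>R x) \<le> p (c *\<^sub>R x + (c * t) *\<^sub>R y) - c * t * p y"
      by (rule push_down_le[OF p]) (use c t in simp)
    also have "c *\<^sub>R x + (c * t) *\<^sub>R y = c *\<^sub>R (x + t *\<^sub>R y)" by (simp add: algebra_simps)
    also have "p \<dots> = c * p (x + t *\<^sub>R y)" using sublinear_scale[OF p] c by simp
    finally show "push_down p y (c *\<^sub>R x) / c \<le> p (x + t *\<^sub>R y) - t * p y"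
      using c by (simp add: field_simps)
  qed
  then show "push_down p y (c *\<^sub>R x) \<le> c * push_down p y x" using c by (simp add: field_simps)
next
  show "push_down p y 0 = 0"
  proof (rule antisym)
    show "push_down p y 0 \<le> 0" using push_down_le[OF p, of 0 y 0] sublinear_zero[OF p] by simp
    show "0 \<le> push_down p y 0" by (rule push_down_ge) (simp add: sublinear_scale[OF p])
  qed
qed

lemma push_down_le_self: "sublinear p \<Longrightarrow> push_down p y x \<le> p x"
  using push_down_le[of p 0 y x] by simp

text \<open>Minimality gives \<open>push_down q y = q\<close>; parameter 1 in
  \<open>push_down_le\<close> then reads as superadditivity of \<open>q\<close>.\<close>

lemma minimal_sublinear_linear:
  assumes q: "sublinear q" and min: "\<And>r. sublinear r \<Longrightarrow> (\<And>x. r x \<le> q x) \<Longrightarrow> r = q"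
  shows "linear q"
proof -
  have add: "q (x + y) = q x + q y" for x y
  proof (rule antisym)
    have "push_down q y = q"
      by (rule min) (use q in \<open>auto intro: sublinear_push_down push_down_le_self\<close>)
    then show "q x + q y \<le> q (x + y)" using push_down_le[OF q, of 1 y x] by simp
  qed (rule sublinear_add[OF q])
  have neg: "q (- x) = - q x" for x
    using add[of x "- x"] sublinear_zero[OF q] by simp
  have "q (c *\<^sub>R x) = c * q x" for c x
    using sublinear_scale[OF q, of c x] sublinear_scale[OF q, of "- c" x] neg[of "c *\<^sub>R x"]
    by (cases "c \<ge> 0") auto
  then show ?thesis using add by (intro linearI) auto
qed

text \<open>Zorn's lemma yields a minimal sublinear functional below \<open>p\<close>, which is
  linear by \<open>minimal_sublinear_linear\<close>. A nonempty chain is bounded by its pointwise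
  infimum.\<close>

lemma ex_linear_le_sublinear:
  fixes p :: "'v::real_vector \<Rightarrow> real"
  assumes p: "sublinear p"
  obtains f where "linear f" "\<And>x. f x \<le> p x"
proof -
  define S where "S = {q. sublinear q \<and> (\<forall>x. q x \<le> p x)}"
  \<comment> \<open>The order is reversed, so that maximal elements for Zorn's lemma are minimal
    functionals.\<close>
  define R where "R = {(q, r). q \<in> S \<and> r \<in> S \<and> (\<forall>x. r x \<le> q x)}"
  have field: "Field R = S" unfolding R_def Field_def by auto
  have po: "Partial_order R"
    unfolding partial_order_on_def preorder_on_def field
    by (auto simp: R_def refl_on_def trans_def antisym_def intro: order_trans intro!: ext antisym)
  have "\<exists>u\<in>Field R. \<forall>a\<in>C. (a, u) \<in> R" if C: "C \<in> Chains R" for C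
  proof (cases "C = {}")
    case True
    then show ?thesis using p by (auto simp: field S_def)
  next
    case False
    have CS: "C \<subseteq> S" using C unfolding Chains_def R_def by auto
    have sub: "sublinear q" if "q \<in> C" for q using that CS by (auto simp: S_def)
    define u where "u x = (INF q\<in>C. q x)" for x
    have low: "u x \<le> q x" if "q \<in> C" for q x
      unfolding u_def
    proof (rule cINF_lower[OF _ that], rule bdd_belowI2[where m = "- p (- x)"])
      fix q assume q: "q \<in> C"
      then have "q (- x) \<le> p (- x)" using CS by (auto simp: S_def)
      then show "- p (- x) \<le> q x" using sublinear_minus_ge[OF sub[OF q], of x] by simp
    qed
    have gr: "b \<le> u x" if "\<And>q. q \<in> C \<Longrightarrow> b \<le> q x" for b x
      unfolding u_def using False that by (intro cINF_greatest)
    have "sublinear u"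
    proof (rule sublinearI)
      fix x y
      have "u (x + y) - q' y \<le> u x" if q': "q' \<in> C" for q'
      proof (rule gr)
        fix q assume q: "q \<in> C"
        \<comment> \<open>In a chain the smaller of \<open>q\<close> and \<open>q'\<close> can serve
          at both points.\<close>
        have "(q, q') \<in> R \<or> (q', q) \<in> R" using C q q' unfolding Chains_def by auto
        then have "\<exists>r\<in>C. r x \<le> q x \<and> r y \<le> q' y" using q q' by (auto simp: R_def)
        then obtain r where r: "r \<in> C" "r x \<le> q x" "r y \<le> q' y" by blast
        show "u (x + y) - q' y \<le> q x"
          using low[OF r(1), of "x + y"] sublinear_add[OF sub[OF r(1)], of x y] r by simp
      qed
      then have "u (x + y) - u x \<le> u y" by (intro gr) (simp add: algebra_simps)
      then show "u (x + y) \<le> u x + u y" by simp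
    next
      fix c :: real and x assume c: "c > 0"
      have "u (c *\<^sub>R x) / c \<le> u x"
      proof (rule gr)
        fix q assume q: "q \<in> C"
        show "u (c *\<^sub>R x) / c \<le> q x"
          using low[OF q, of "c *\<^sub>R x"] sublinear_scale[OF sub[OF q], of c x] c
          by (simp add: field_simps)
      qed
      then show "u (c *\<^sub>R x) \<le> c * u x" using c by (simp add: field_simps)
    next
      show "u 0 = 0" unfolding u_def using False by (simp add: sublinear_zero[OF sub] cong: INF_cong)
    qed
    moreover have "u x \<le> p x" for x
      using False low CS by (force simp: S_def intro: order_trans)
    ultimately have "u \<in> S" by (simp add: S_def)
    then show ?thesis unfolding field using low CS by (intro bexI[of _ u]) (auto simp: R_def)
  qed
  from Zorns_po_lemma[OF po this]
  obtain q where q: "q \<in> S" "\<And>r. r \<in> S \<Longrightarrow> (q, r) \<in> R \<Longrightarrow> r = q" unfolding field by blast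
  have "linear q"
  proof (rule minimal_sublinear_linear)
    fix r assume "sublinear r" "\<And>x. r x \<le> q x"
    moreover from this have "r \<in> S" using q(1) by (auto simp: S_def intro: order_trans)
    ultimately show "r = q" using q by (auto simp: R_def)
  qed (use q in \<open>simp add: S_def\<close>)
  with that q(1) show ?thesis by (auto simp: S_def)
qed

section \<open>Continuity in locally convex spaces and Minkowski gauges\<close>

lemma continuous_scaleR_left:
  fixes v :: "'v::hausdorff_lcs"
  shows "continuous_on UNIV (\<lambda>c. c *\<^sub>R v)"
  unfolding continuous_on_def
proof (intro ballI)
  fix c :: real
  have "filterlim (\<lambda>c. (c, v)) (nhds c \<times>\<^sub>F nhds v) (nhds c)"
    by (intro filterlim_Pair filterlim_ident tendsto_const)
  from filterlim_compose[OF tendsto_scaleR_Pair this]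
  have "((\<lambda>c. c *\<^sub>R v) \<longlongrightarrow> c *\<^sub>R v) (nhds c)" by simp
  then show "((\<lambda>c. c *\<^sub>R v) \<longlongrightarrow> c *\<^sub>R v) (at c within UNIV)"
    by (rule tendsto_mono[rotated]) (simp add: at_within_def)
qed

lemma continuous_scaleR_right:
  "continuous_on UNIV (\<lambda>v::'v::hausdorff_lcs. c *\<^sub>R v)"
  unfolding continuous_on_def
proof (intro ballI)
  fix v :: 'v
  have "filterlim (\<lambda>v. (c, v)) (nhds c \<times>\<^sub>F nhds v) (nhds v)"
    by (intro filterlim_Pair filterlim_ident tendsto_const)
  from filterlim_compose[OF tendsto_scaleR_Pair this]
  have "((\<lambda>v. c *\<^sub>R v) \<longlongrightarrow> c *\<^sub>R v) (nhds v)" by simp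
  then show "((\<lambda>v. c *\<^sub>R v) \<longlongrightarrow> c *\<^sub>R v) (at v within UNIV)"
    by (rule tendsto_mono[rotated]) (simp add: at_within_def)
qed

text \<open>The Minkowski functional of \<open>U\<close>. For an open \<open>U\<close> containing 0
  the infimum is over a nonempty set, by \<open>absorbing_open\<close>.\<close>

definition gauge_of :: "'v::real_vector set \<Rightarrow> 'v \<Rightarrow> real" where
  "gauge_of U x = Inf {t. t > 0 \<and> (1 / t) *\<^sub>R x \<in> U}"

lemma gauge_of_le: "t > 0 \<Longrightarrow> (1 / t) *\<^sub>R x \<in> U \<Longrightarrow> gauge_of U x \<le> t"
  unfolding gauge_of_def by (rule cInf_lower) (auto intro!: bdd_belowI[of _ 0])

lemma absorbing_open:
  fixes U :: "'v::hausdorff_lcs set"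
  assumes U: "open U" "0 \<in> U"
  shows "\<exists>t>0. (1 / t) *\<^sub>R x \<in> U"
proof -
  have "open ((\<lambda>c. c *\<^sub>R x) -` U)"
    using continuous_scaleR_left U(1) by (rule open_vimage[rotated])
  moreover have "(0::real) \<in> (\<lambda>c. c *\<^sub>R x) -` U" using U by simp
  ultimately obtain d where d: "d > 0" "ball 0 d \<subseteq> (\<lambda>c. c *\<^sub>R x) -` U"
    using open_contains_ball by metis
  have "d / 2 \<in> ball 0 d" using d by (simp add: dist_real_def)
  then have "(d / 2) *\<^sub>R x \<in> U" using d(2) by blast
  then show ?thesis using d by (intro exI[of _ "2 / d"]) auto
qed

lemma gauge_of_ge:
  fixes U :: "'v::hausdorff_lcs set"
  assumes "open U" "0 \<in> U" "\<And>t. t > 0 \<Longrightarrow> (1 / t) *\<^sub>R x \<in> U \<Longrightarrow> b \<le> t"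
  shows "b \<le> gauge_of U x"
  unfolding gauge_of_def using absorbing_open[OF assms(1,2), of x] assms(3)
  by (intro cInf_greatest) auto

text \<open>Subadditivity comes from convexity: if \<open>x\<close> divided by \<open>s\<close> and
  \<open>y\<close> divided by \<open>t\<close> lie in \<open>U\<close>, so does their combination
  with weights \<open>s / (s + t)\<close> and \<open>t / (s + t)\<close>, which is
  \<open>x + y\<close> divided by \<open>s + t\<close>.\<close>

lemma sublinear_gauge_of:
  fixes U :: "'v::hausdorff_lcs set"
  assumes U: "open U" "0 \<in> U" "convex U"
  shows "sublinear (gauge_of U)"
proof (rule sublinearI)
  fix x y :: 'v
  have "gauge_of U (x + y) - t \<le> gauge_of U x" if t: "t > 0" "(1 / t) *\<^sub>R y \<in> U" for t
  proof (rule gauge_of_ge[OF U(1,2)])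
    fix s :: real assume s: "s > 0" "(1 / s) *\<^sub>R x \<in> U"
    have "(s / (s + t)) *\<^sub>R ((1 / s) *\<^sub>R x) + (t / (s + t)) *\<^sub>R ((1 / t) *\<^sub>R y) \<in> U"
      using s t by (intro convexD[OF U(3)]) (auto simp: add_divide_distrib[symmetric])
    also have "(s / (s + t)) *\<^sub>R ((1 / s) *\<^sub>R x) + (t / (s + t)) *\<^sub>R ((1 / t) *\<^sub>R y)
        = (1 / (s + t)) *\<^sub>R (x + y)"
      using s t by (simp add: scaleR_add_right)
    finally show "gauge_of U (x + y) - t \<le> s"
      using gauge_of_le[of "s + t" "x + y" U] s t by simp
  qed
  then have "gauge_of U (x + y) - gauge_of U x \<le> gauge_of U y"
    by (intro gauge_of_ge[OF U(1,2)]) (simp add: algebra_simps)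
  then show "gauge_of U (x + y) \<le> gauge_of U x + gauge_of U y" by simp
next
  fix c :: real and x :: 'v assume c: "c > 0"
  have "gauge_of U (c *\<^sub>R x) / c \<le> gauge_of U x"
  proof (rule gauge_of_ge[OF U(1,2)])
    fix t :: real assume "t > 0" "(1 / t) *\<^sub>R x \<in> U"
    then show "gauge_of U (c *\<^sub>R x) / c \<le> t"
      using gauge_of_le[of "c * t" "c *\<^sub>R x" U] c by (simp add: field_simps)
  qed
  then show "gauge_of U (c *\<^sub>R x) \<le> c * gauge_of U x" using c by (simp add: field_simps)
next
  show "gauge_of U 0 = 0"
  proof (rule antisym)
    show "gauge_of U 0 \<le> 0"
      by (rule field_le_epsilon) (use U gauge_of_le[of _ 0 U] in simp)
    show "0 \<le> gauge_of U 0" by (rule gauge_of_ge[OF U(1,2)]) simp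
  qed
qed

text \<open>An upper bound alone suffices: near \<open>a\<close> both \<open>2 / \<epsilon>\<close>
  and \<open>- 2 / \<epsilon>\<close> times \<open>x - a\<close> lie in \<open>U\<close>, which
  bounds \<open>f x - f a\<close> on both sides by \<open>\<epsilon> / 2\<close>.\<close>

lemma continuous_linear_bounded_on_open:
  fixes f :: "'v::hausdorff_lcs \<Rightarrow> real"
  assumes f: "linear f" and U: "open U" "0 \<in> U" and le: "\<And>x. x \<in> U \<Longrightarrow> f x \<le> 1"
  shows "continuous_on UNIV f"
proof -
  have "\<forall>\<^sub>F x in nhds a. dist (f x) (f a) < \<epsilon>" if \<epsilon>: "\<epsilon> > 0" for a \<epsilon>
  proof -
    define g where "g c x = c *\<^sub>R (x - a)" for c :: real and x
    have cont: "continuous_on UNIV (g c)" for c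
    proof -
      have "continuous_on UNIV ((\<lambda>x. c *\<^sub>R x) \<circ> (\<lambda>x. x - a))"
        by (rule continuous_on_compose)
          (auto intro: continuous_intros continuous_on_subset[OF continuous_scaleR_right])
      then show ?thesis by (simp add: g_def o_def)
    qed
    let ?W = "g (2 / \<epsilon>) -` U \<inter> g (- 2 / \<epsilon>) -` U"
    have "open ?W" by (intro open_Int open_vimage U cont)
    moreover have "a \<in> ?W" using U by (simp add: g_def)
    moreover have "dist (f x) (f a) < \<epsilon>" if "x \<in> ?W" for x
    proof -
      have "f (g (2 / \<epsilon>) x) \<le> 1" "f (g (- 2 / \<epsilon>) x) \<le> 1" using that le by auto
      then have "2 / \<epsilon> * (f x - f a) \<le> 1" "- 2 / \<epsilon> * (f x - f a) \<le> 1"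
        unfolding g_def linear_cmul[OF f] linear_diff[OF f] by simp_all
      then show ?thesis using \<epsilon> by (auto simp: dist_real_def field_simps abs_if)
    qed
    ultimately show ?thesis unfolding eventually_nhds by blast
  qed
  then have "(f \<longlongrightarrow> f a) (nhds a)" for a by (auto simp: tendsto_iff)
  then show ?thesis
    unfolding continuous_on_def
    by (metis at_within_def inf_le1 tendsto_mono)
qed

text \<open>The gauge of a convex neighbourhood of 0 omitting \<open>v = a - b\<close> is at least 1
  at \<open>v\<close>. Pushing it down along \<open>v\<close> before applying Hahn-Banach takes the
  place of extending a functional from the line through \<open>v\<close>: it forces
  \<open>\<phi> (- v)\<close> to be at most -1. Domination by the gauge gives continuity.\<close>

theorem separating_functional:
  fixes a b :: "'v::hausdorff_lcs"
  assumes "a \<noteq> b"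
  obtains \<phi> :: "'v \<Rightarrow> real" where "linear \<phi>" "continuous_on UNIV \<phi>" "\<phi> a \<noteq> \<phi> b"
proof -
  define v where "v = a - b"
  have v: "v \<noteq> 0" using assms by (simp add: v_def)
  have "open (- {v})" by (simp add: open_Compl)
  then obtain U where U: "open U" "convex U" "0 \<in> U" "v \<notin> U"
    using locally_convex[of "- {v}"] v by auto
  let ?p = "gauge_of U"
  have p: "sublinear ?p" using U by (intro sublinear_gauge_of)
  have pv: "1 \<le> ?p v"
  proof (rule gauge_of_ge[OF U(1,3)], rule ccontr)
    fix t :: real assume t: "t > 0" "(1 / t) *\<^sub>R v \<in> U" "\<not> 1 \<le> t"
    then have "t *\<^sub>R ((1 / t) *\<^sub>R v) + (1 - t) *\<^sub>R 0 \<in> U" using U by (intro convexD) auto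
    then show False using t U by simp
  qed
  obtain \<phi> where \<phi>: "linear \<phi>" "\<And>x. \<phi> x \<le> push_down ?p v x"
    using ex_linear_le_sublinear[OF sublinear_push_down[OF p]] by metis
  have "\<phi> (- v) \<le> ?p (- v + 1 *\<^sub>R v) - 1 * ?p v"
    by (rule order_trans[OF \<phi>(2) push_down_le[OF p]]) simp
  then have "\<phi> v \<ge> 1" using pv sublinear_zero[OF p] linear_neg[OF \<phi>(1)] by simp
  then have "\<phi> a \<noteq> \<phi> b" unfolding v_def by (simp add: linear_diff[OF \<phi>(1)])
  moreover have "continuous_on UNIV \<phi>"
  proof (rule continuous_linear_bounded_on_open[OF \<phi>(1) U(1,3)])
    fix x assume "x \<in> U"
    then have "?p x \<le> 1" using gauge_of_le[of 1 x U] by simp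
    then show "\<phi> x \<le> 1" using \<phi>(2) push_down_le_self[OF p] by (meson order_trans)
  qed
  ultimately show ?thesis using \<phi>(1) that by blast
qed

section \<open>Functionals on affine continuous functions\<close>

text \<open>Continuous linear functionals do not form a large enough class: composed with a map of
  the action, they are only known to be affine and continuous on \<open>K\<close>.\<close>

definition affine_continuous :: "'v::{real_vector,t2_space} set \<Rightarrow> ('v \<Rightarrow> real) set" where
  "affine_continuous K = {h. continuous_on K h \<and>
     (\<forall>\<xi>\<in>K. \<forall>\<eta>\<in>K. \<forall>t\<in>{0..1}. h ((1 - t) *\<^sub>R \<xi> + t *\<^sub>R \<eta>) = (1 - t) * h \<xi> + t * h \<eta>)}"

lemma affine_continuousD:
  "h \<in> affine_continuous K \<Longrightarrow> \<xi> \<in> K \<Longrightarrow> \<eta> \<in> K \<Longrightarrow> 0 \<le> t \<Longrightarrow> t \<le> 1 \<Longrightarrow>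
     h ((1 - t) *\<^sub>R \<xi> + t *\<^sub>R \<eta>) = (1 - t) * h \<xi> + t * h \<eta>"
  by (simp add: affine_continuous_def)

lemma affine_continuous_const: "(\<lambda>x. c) \<in> affine_continuous K"
  by (simp add: affine_continuous_def algebra_simps)

lemma affine_continuous_add:
  "f \<in> affine_continuous K \<Longrightarrow> g \<in> affine_continuous K \<Longrightarrow> (\<lambda>x. f x + g x) \<in> affine_continuous K"
  unfolding affine_continuous_def
  by (auto intro!: continuous_on_add) (simp add: distrib_left)

lemma affine_continuous_cmult:
  "f \<in> affine_continuous K \<Longrightarrow> (\<lambda>x. c * f x) \<in> affine_continuous K"
  unfolding affine_continuous_def
  by (auto intro!: continuous_on_mult_left) (simp add: distrib_left mult.left_commute)

lemma affine_continuous_sum: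
  assumes "finite F" "\<And>i. i \<in> F \<Longrightarrow> f i \<in> affine_continuous K"
  shows "(\<lambda>x. \<Sum>i\<in>F. f i x) \<in> affine_continuous K"
  using assms
  by (induction F) (simp_all add: affine_continuous_const affine_continuous_add)

lemma affine_continuous_linear:
  "linear \<phi> \<Longrightarrow> continuous_on UNIV \<phi> \<Longrightarrow> \<phi> \<in> affine_continuous K"
  by (auto simp: affine_continuous_def linear_add linear_cmul intro: continuous_on_subset)

text \<open>The triple \<open>(p, q, a)\<close> stands for the functional \<open>a \<delta>\<^sub>p - (1 - a) \<delta>\<^sub>q\<close>.\<close>

definition signed_eval :: "'v \<times> 'v \<times> real \<Rightarrow> ('v \<Rightarrow> real) \<Rightarrow> real" where
  "signed_eval s h = snd (snd s) * h (fst s) - (1 - snd (snd s)) * h (fst (snd s))"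

lemma continuous_on_signed_eval:
  fixes K :: "'v::{real_vector,t2_space} set"
  assumes "h \<in> affine_continuous K"
  shows "continuous_on (K \<times> K \<times> {0..1}) (\<lambda>s. signed_eval s h)"
proof -
  have h: "continuous_on K h" using assms by (simp add: affine_continuous_def)
  show ?thesis
    unfolding signed_eval_def
    by (intro continuous_intros continuous_on_compose2[OF h]) auto
qed

text \<open>The added mass \<open>t\<close> at \<open>r\<close> is merged with the point of matching
  sign, \<open>p\<close> or \<open>q\<close>, by passing to a barycentre in \<open>K\<close>. The
  absolute masses still sum to 1.\<close>

lemma signed_eval_mix:
  fixes K :: "'v::{real_vector,t2_space} set"
  assumes K: "convex K" and s: "s \<in> K \<times> K \<times> {0..1}" and r: "r \<in> K" and t: "0 < t" "t \<le> 1"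
    and \<sigma>: "\<sigma> = 1 \<or> \<sigma> = -1"
  obtains s' where "s' \<in> K \<times> K \<times> {0..1}"
    "\<And>h. h \<in> affine_continuous K \<Longrightarrow> signed_eval s' h = (1 - t) * signed_eval s h + t * (\<sigma> * h r)"
proof -
  obtain p q a where s_eq: "s = (p, q, a)" and pqa: "p \<in> K" "q \<in> K" "0 \<le> a" "a \<le> 1"
    using s by auto
  \<comment> \<open>\<open>k\<close> is the barycentre of mass \<open>b\<close> at \<open>c\<close>
    and mass \<open>t\<close> at \<open>r\<close>; since \<open>t > 0\<close>, this makes sense even
    for \<open>b = 0\<close>.\<close>
  have mix: "\<exists>k\<in>K. \<forall>h\<in>affine_continuous K. (b + t) * h k = b * h c + t * h r"
    if "c \<in> K" "0 \<le> b" for b c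
  proof (intro bexI ballI)
    let ?u = "t / (b + t)"
    have u: "0 \<le> ?u" "?u \<le> 1" using t that by auto
    show "(1 - ?u) *\<^sub>R c + ?u *\<^sub>R r \<in> K" using u that r by (intro convexD[OF K]) auto
    fix h assume "h \<in> affine_continuous K"
    from affine_continuousD[OF this that(1) r u]
    have "(b + t) * h ((1 - ?u) *\<^sub>R c + ?u *\<^sub>R r) = (b + t) * (1 - ?u) * h c + (b + t) * ?u * h r"
      by (simp only: distrib_left mult.assoc)
    moreover have "(b + t) * ?u = t" "(b + t) * (1 - ?u) = b" using t that by (auto simp: field_simps)
    ultimately show "(b + t) * h ((1 - ?u) *\<^sub>R c + ?u *\<^sub>R r) = b * h c + t * h r" by simp
  qed
  show ?thesis
  proof (cases "\<sigma> = 1")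
    case True
    have "0 \<le> (1 - t) * a" "(1 - t) * a \<le> 1 - t"
      using t pqa mult_left_mono[of a 1 "1 - t"] by auto
    moreover from mix[OF pqa(1) this(1)] obtain k where
      "k \<in> K" "\<forall>h\<in>affine_continuous K. ((1 - t) * a + t) * h k = (1 - t) * a * h p + t * h r"
      by blast
    ultimately show ?thesis using t pqa True
      by (intro that[of "(k, q, (1 - t) * a + t)"]) (auto simp: signed_eval_def s_eq algebra_simps)
  next
    case False
    have "0 \<le> (1 - t) * (1 - a)" "0 \<le> (1 - t) * a" "(1 - t) * a \<le> 1"
      using t pqa by (auto intro: mult_le_one)
    moreover from mix[OF pqa(2) this(1)] obtain k where
      "k \<in> K" "\<forall>h\<in>affine_continuous K.
         ((1 - t) * (1 - a) + t) * h k = (1 - t) * (1 - a) * h q + t * h r"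
      by blast
    moreover have "1 - (1 - t) * a = (1 - t) * (1 - a) + t" by (simp add: algebra_simps)
    ultimately show ?thesis using t pqa False \<sigma>
      by (intro that[of "(p, k, (1 - t) * a)"]) (auto simp: signed_eval_def s_eq algebra_simps)
  qed
qed

text \<open>\<open>bound\<close> says that \<open>l\<close> is contractive for the supremum norm on
  \<open>K\<close>: applied to the negative of \<open>f\<close> it also bounds \<open>l f\<close>
  from below. In particular \<open>l f\<close> depends only on the values of \<open>f\<close> on
  \<open>K\<close>.\<close>

locale affine_functional =
  fixes K :: "'v::{real_vector,t2_space} set" and l :: "('v \<Rightarrow> real) \<Rightarrow> real"
  assumes K: "compact K" "convex K" "K \<noteq> {}"
    and add: "f \<in> affine_continuous K \<Longrightarrow> g \<in> affine_continuous K \<Longrightarrow> l (\<lambda>x. f x + g x) = l f + l g"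
    and cmult: "f \<in> affine_continuous K \<Longrightarrow> l (\<lambda>x. c * f x) = c * l f"
    and bound: "f \<in> affine_continuous K \<Longrightarrow> (\<And>x. x \<in> K \<Longrightarrow> \<bar>f x\<bar> \<le> b) \<Longrightarrow> l f \<le> b"
begin

lemma compact_parameters: "compact (K \<times> K \<times> {0..1::real})"
  using K by (simp add: compact_Times)

lemma sum:
  assumes "finite F" "\<And>i. i \<in> F \<Longrightarrow> f i \<in> affine_continuous K"
  shows "l (\<lambda>x. \<Sum>i\<in>F. f i x) = (\<Sum>i\<in>F. l (f i))"
  using assms
proof (induction F)
  case empty
  show ?case using cmult[OF affine_continuous_const, of 0 0] by simp
next
  case (insert i F)
  then show ?case by (simp add: add affine_continuous_sum)
qed

text \<open>Minimise the quadratic distance from \<open>l\<close> to the signed evaluations. With \<open>c\<close> the residual at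
  the minimiser \<open>s\<close>, moving from \<open>s\<close> towards \<open>\<plusminus>\<delta>\<^sub>r\<close> shows that \<open>\<Sum>h. c h * h\<close> is bounded on \<open>K\<close>
  by its value under \<open>s\<close>; the bound on \<open>l\<close> then forces \<open>c = 0\<close>.\<close>

lemma ex_signed_eval_finite:
  assumes F: "finite F" "F \<subseteq> affine_continuous K"
  shows "\<exists>s \<in> K \<times> K \<times> {0..1}. \<forall>h\<in>F. signed_eval s h = l h"
proof -
  let ?S = "K \<times> K \<times> {0..1::real}"
  have Fh: "h \<in> affine_continuous K" if "h \<in> F" for h using F that by blast
  have "continuous_on ?S (\<lambda>s. \<Sum>h\<in>F. (l h - signed_eval s h)\<^sup>2)"
    by (intro continuous_intros continuous_on_signed_eval Fh)
  moreover have "?S \<noteq> {}" using K by simp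
  ultimately obtain s where s: "s \<in> ?S"
    and min: "\<And>s'. s' \<in> ?S \<Longrightarrow>
      (\<Sum>h\<in>F. (l h - signed_eval s h)\<^sup>2) \<le> (\<Sum>h\<in>F. (l h - signed_eval s' h)\<^sup>2)"
    using continuous_attains_inf[OF compact_parameters] by blast
  define c where "c h = l h - signed_eval s h" for h
  have var: "\<sigma> * (\<Sum>h\<in>F. c h * h r) \<le> (\<Sum>h\<in>F. c h * signed_eval s h)"
    if r: "r \<in> K" and \<sigma>: "\<sigma> = 1 \<or> \<sigma> = -1" for r \<sigma>
  proof -
    \<comment> \<open>\<open>d\<close> is the direction from \<open>s\<close> towards the signed
      point mass at \<open>r\<close>; a step of size \<open>t\<close> turns the residual
      \<open>c\<close> into \<open>c - t * d\<close>.\<close>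
    define d where "d h = \<sigma> * h r - signed_eval s h" for h
    have "2 * (\<Sum>h\<in>F. c h * d h) \<le> t * (\<Sum>h\<in>F. (d h)\<^sup>2)" if t: "0 < t" "t \<le> 1" for t
    proof -
      obtain s' where s': "s' \<in> ?S" "\<And>h. h \<in> affine_continuous K \<Longrightarrow>
          signed_eval s' h = (1 - t) * signed_eval s h + t * (\<sigma> * h r)"
        using signed_eval_mix[OF K(2) s r t \<sigma>] by metis
      have "(\<Sum>h\<in>F. (c h)\<^sup>2) \<le> (\<Sum>h\<in>F. (l h - signed_eval s' h)\<^sup>2)"
        using min[OF s'(1)] by (simp add: c_def)
      also have "\<dots> = (\<Sum>h\<in>F. (c h - t * d h)\<^sup>2)"
        by (intro sum.cong refl) (simp add: s'(2) Fh c_def d_def algebra_simps)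
      also have "\<dots> = (\<Sum>h\<in>F. (c h)\<^sup>2) - t * (2 * (\<Sum>h\<in>F. c h * d h) - t * (\<Sum>h\<in>F. (d h)\<^sup>2))"
        by (simp add: power2_diff power_mult_distrib sum.distrib sum_subtractf sum_distrib_left
            right_diff_distrib power2_eq_square mult_ac)
      finally have "t * (2 * (\<Sum>h\<in>F. c h * d h) - t * (\<Sum>h\<in>F. (d h)\<^sup>2)) \<le> 0" by simp
      then show ?thesis using t by (simp add: mult_le_0_iff)
    qed
    \<comment> \<open>Letting \<open>t\<close> decrease to 0 leaves the first-order condition at the
      minimiser.\<close>
    then have ev: "\<forall>\<^sub>F t in at_right 0. 2 * (\<Sum>h\<in>F. c h * d h) \<le> t * (\<Sum>h\<in>F. (d h)\<^sup>2)"
      by (auto simp: eventually_at_right_field intro!: exI[of _ 1])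
    have "((\<lambda>t. t * (\<Sum>h\<in>F. (d h)\<^sup>2)) \<longlongrightarrow> 0 * (\<Sum>h\<in>F. (d h)\<^sup>2)) (at_right 0)"
      by (intro tendsto_intros)
    from tendsto_lowerbound[OF this ev] have "(\<Sum>h\<in>F. c h * d h) \<le> 0" by simp
    then show ?thesis
      by (simp add: d_def right_diff_distrib sum_subtractf sum_distrib_left mult_ac)
  qed
  have "(\<Sum>h\<in>F. c h * l h) = l (\<lambda>x. \<Sum>h\<in>F. c h * h x)"
    using F Fh by (simp add: sum affine_continuous_cmult cmult)
  also have "\<dots> \<le> (\<Sum>h\<in>F. c h * signed_eval s h)"
  proof (rule bound)
    show "(\<lambda>x. \<Sum>h\<in>F. c h * h x) \<in> affine_continuous K"
      using F Fh by (intro affine_continuous_sum affine_continuous_cmult)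
    show "\<bar>\<Sum>h\<in>F. c h * h x\<bar> \<le> (\<Sum>h\<in>F. c h * signed_eval s h)" if "x \<in> K" for x
      using var[OF that, of 1] var[OF that, of "-1"] by simp
  qed
  \<comment> \<open>The chain of inequalities bounds a sum by itself minus the sum of the squared
    residuals, which must therefore vanish.\<close>
  also have "(\<Sum>h\<in>F. c h * signed_eval s h) = (\<Sum>h\<in>F. c h * l h) - (\<Sum>h\<in>F. (c h)\<^sup>2)"
    unfolding sum_subtractf[symmetric]
    by (intro sum.cong refl) (simp add: c_def power2_eq_square algebra_simps)
  finally have "(\<Sum>h\<in>F. (c h)\<^sup>2) \<le> 0" by simp
  then have "\<forall>h\<in>F. c h = 0"
    using F sum_nonneg_eq_0_iff[of F "\<lambda>h. (c h)\<^sup>2"] sum_nonneg[of F "\<lambda>h. (c h)\<^sup>2"] by simp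
  then show ?thesis using s by (auto simp: c_def)
qed

text \<open>Each \<open>h\<close> cuts out a closed set of parameters in a compact space. The finite
  case is the finite intersection property of these sets.\<close>

theorem ex_signed_eval:
  obtains p q a where "p \<in> K" "q \<in> K" "0 \<le> a" "a \<le> 1"
    "\<And>h. h \<in> affine_continuous K \<Longrightarrow> l h = a * h p - (1 - a) * h q"
proof -
  let ?S = "K \<times> K \<times> {0..1::real}"
  have "?S \<inter> (\<Inter>h\<in>affine_continuous K. {s \<in> ?S. signed_eval s h = l h}) \<noteq> {}"
  proof (rule compact_imp_fip_image)
    show "compact ?S" by (rule compact_parameters)
  next
    fix h assume "h \<in> affine_continuous K"
    then show "closed {s \<in> ?S. signed_eval s h = l h}"
      by (intro continuous_closed_preimage_constant continuous_on_signed_eval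
          compact_imp_closed compact_parameters)
  next
    fix F assume "finite F" "F \<subseteq> affine_continuous K"
    from ex_signed_eval_finite[OF this]
    show "?S \<inter> (\<Inter>h\<in>F. {s \<in> ?S. signed_eval s h = l h}) \<noteq> {}" by blast
  qed
  then obtain s where "s \<in> ?S" "\<forall>h\<in>affine_continuous K. signed_eval s h = l h" by blast
  then show ?thesis
    by (intro that[of "fst s" "fst (snd s)" "snd (snd s)"]) (auto simp: signed_eval_def)
qed

text \<open>The constant 1 gives \<open>a - (1 - a) = 1\<close>, so the negative mass
  disappears.\<close>

corollary ex_eval:
  assumes "l (\<lambda>x. 1) = 1"
  obtains p where "p \<in> K" "\<And>h. h \<in> affine_continuous K \<Longrightarrow> l h = h p"
proof -
  obtain p q a where *: "p \<in> K" "q \<in> K"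
    "\<And>h. h \<in> affine_continuous K \<Longrightarrow> l h = a * h p - (1 - a) * h q"
    using ex_signed_eval by metis
  have "a = 1" using *(3)[OF affine_continuous_const, of 1] assms by simp
  with * that show ?thesis by simp
qed

end

section \<open>Affine actions\<close>

text \<open>Rescale \<open>f\<close> to norm \<open>\<delta>\<close>. The closure hypothesis
  concerns only real multiples of \<open>f\<close>, so it can be checked for orbit functions, whose
  real multiples are again orbit functions.\<close>

lemma complex_linear_on_bound:
  assumes L: "complex_linear_on X L" and f: "f \<in> X" "\<And>c. cscale (complex_of_real c) f \<in> X"
    and \<delta>: "\<delta> > 0" and le: "\<And>g. g \<in> X \<Longrightarrow> norm g \<le> \<delta> \<Longrightarrow> cmod (L g) \<le> 1"
  shows "cmod (L f) \<le> 1 / \<delta> * norm f"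
proof -
  have real: "cscale (complex_of_real c) f = c *\<^sub>R f" for c
    by (rule bcontfun_eqI) (simp add: cscale_apply scaleR_conv_of_real)
  have hom: "L (c *\<^sub>R f) = complex_of_real c * L f" for c
    using L f(1) unfolding complex_linear_on_def real[symmetric] by blast
  have mem: "c *\<^sub>R f \<in> X" for c using f(2)[of c] by (simp add: real)
  show ?thesis
  proof (cases "f = 0")
    case True
    then show ?thesis using hom[of 0] by simp
  next
    case False
    have "cmod (L ((\<delta> / norm f) *\<^sub>R f)) \<le> 1"
      by (rule le[OF mem]) (use False \<delta> in simp)
    then have "\<delta> / norm f * cmod (L f) \<le> 1"
      using \<delta> by (simp add: hom norm_mult norm_divide)
    then show ?thesis using False \<delta> by (simp add: field_simps)
  qed
qed

text \<open>Bounded continuous functions are integrable for the probability measure behind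
  \<open>\<mu>\<close>, so the integral is additive on them.\<close>

lemma complex_linear_on_cintegral:
  assumes \<mu>: "\<mu> \<in> prob_compact"
  shows "complex_linear_on UNIV (\<lambda>f. cintegral \<mu> (apply_bcontfun f))"
proof -
  let ?N = "pos_variation (\<lambda>A. Re (\<mu> A))"
  have a: "complex_borel_measure \<mu>" "\<And>A. 0 \<le> Re (\<mu> A)"
    using \<mu> unfolding prob_compact_def Meas_def by auto
  interpret N: prob_space ?N by (rule cintegral_prob[OF \<mu>])
  have int: "integrable ?N (apply_bcontfun f)" for f :: "_ \<Rightarrow>\<^sub>C complex"
  proof -
    have "apply_bcontfun f \<in> borel_measurable borel"
      by (rule borel_measurable_continuous_onI) simp
    then have "apply_bcontfun f \<in> borel_measurable ?N"
      using measurable_cong_sets[OF pos_variation_nonneg(2)[OF a] refl] by blast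
    then show ?thesis
      by (rule N.integrable_const_bound[rotated, where B = "norm f"]) (auto simp: norm_bounded)
  qed
  show ?thesis
    unfolding complex_linear_on_def cintegral_prob(1)[OF \<mu>]
    using int by (simp add: cscale_apply[abs_def])
qed

text \<open>Separate continuity is the common ground of both claims; joint continuity enters as an
  extra assumption in \<open>orbit_fun_in_UCBr\<close>.\<close>

locale affine_hypergroup_action = hypergroup conv e invol
  for conv :: "('h::t2_space) cmeasure \<Rightarrow> 'h cmeasure \<Rightarrow> 'h cmeasure" and e invol +
  fixes K :: "'v::hausdorff_lcs set" and act :: "'h \<Rightarrow> 'v \<Rightarrow> 'v"
  assumes K: "compact K" "convex K" "K \<noteq> {}"
    and action: "separately_continuous_action conv e K act"
    and affine: "affine_action K act"
begin

lemma act_mem: "\<xi> \<in> K \<Longrightarrow> act x \<xi> \<in> K"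
  using action by (simp add: separately_continuous_action_def hypergroup_action_def)

lemma continuous_act: "continuous_on K (act x)"
  using action by (simp add: separately_continuous_action_def)

lemma continuous_orbit: "\<xi> \<in> K \<Longrightarrow> continuous_on UNIV (\<lambda>x. act x \<xi>)"
  using action by (simp add: separately_continuous_action_def)

lemma continuous_invol: "continuous_on UNIV invol"
  using invol_homeomorphism by (simp add: homeomorphism_def)

lemma affine_continuous_act:
  assumes h: "h \<in> affine_continuous K"
  shows "(\<lambda>\<xi>. h (act x \<xi>)) \<in> affine_continuous K"
  unfolding affine_continuous_def
proof (intro CollectI conjI ballI)
  show "continuous_on K (\<lambda>\<xi>. h (act x \<xi>))"
    using h act_mem unfolding affine_continuous_def
    by (auto intro: continuous_on_compose2[OF _ continuous_act])
  fix \<xi> \<eta> and t :: real assume *: "\<xi> \<in> K" "\<eta> \<in> K" "t \<in> {0..1}"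
  then have "act x ((1 - t) *\<^sub>R \<xi> + t *\<^sub>R \<eta>) = (1 - t) *\<^sub>R act x \<xi> + t *\<^sub>R act x \<eta>"
    using affine by (simp add: affine_action_def)
  then show "h (act x ((1 - t) *\<^sub>R \<xi> + t *\<^sub>R \<eta>)) = (1 - t) * h (act x \<xi>) + t * h (act x \<eta>)"
    using * affine_continuousD[OF h] act_mem by simp
qed

lemma continuous_affine_orbit:
  assumes "h \<in> affine_continuous K" "\<xi> \<in> K"
  shows "continuous_on UNIV (\<lambda>x. h (act x \<xi>))"
  using assms act_mem unfolding affine_continuous_def
  by (auto intro: continuous_on_compose2[OF _ continuous_orbit])

section \<open>Orbit functions, their translates and their function spaces\<close>

definition orbit_fun :: "'v \<Rightarrow> ('v \<Rightarrow> real) \<Rightarrow> ('h \<Rightarrow>\<^sub>C complex)" where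
  "orbit_fun \<xi> h = Bcontfun (\<lambda>y. complex_of_real (h (act y \<xi>)))"

text \<open>\<open>Bcontfun\<close> is meaningful here because \<open>h\<close> is bounded on the
  compact set \<open>K\<close> and orbits are continuous.\<close>

lemma orbit_fun_apply:
  assumes h: "h \<in> affine_continuous K" and \<xi>: "\<xi> \<in> K"
  shows "apply_bcontfun (orbit_fun \<xi> h) y = complex_of_real (h (act y \<xi>))"
proof -
  have "bounded (h ` K)"
    using h K by (auto simp: affine_continuous_def intro: compact_imp_bounded compact_continuous_image)
  then obtain b where b: "\<And>k. k \<in> K \<Longrightarrow> \<bar>h k\<bar> \<le> b" by (auto simp: bounded_iff)
  have "(\<lambda>y. complex_of_real (h (act y \<xi>))) \<in> bcontfun"
    by (rule bcontfun_normI[where b = b])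
      (auto intro!: continuous_intros continuous_affine_orbit h \<xi> b act_mem)
  then show ?thesis by (simp add: orbit_fun_def Bcontfun_inverse)
qed

lemma orbit_fun_add:
  assumes "f \<in> affine_continuous K" "g \<in> affine_continuous K" "\<xi> \<in> K"
  shows "orbit_fun \<xi> (\<lambda>x. f x + g x) = orbit_fun \<xi> f + orbit_fun \<xi> g"
  by (rule bcontfun_eqI) (simp add: assms orbit_fun_apply affine_continuous_add)

lemma orbit_fun_cmult:
  assumes "f \<in> affine_continuous K" "\<xi> \<in> K"
  shows "orbit_fun \<xi> (\<lambda>x. c * f x) = cscale (complex_of_real c) (orbit_fun \<xi> f)"
  by (rule bcontfun_eqI) (simp add: assms orbit_fun_apply affine_continuous_cmult cscale_apply)

lemma norm_orbit_fun_le: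
  assumes "f \<in> affine_continuous K" "\<xi> \<in> K" "\<And>x. x \<in> K \<Longrightarrow> \<bar>f x\<bar> \<le> b"
  shows "norm (orbit_fun \<xi> f) \<le> b"
  by (rule norm_bound) (simp add: assms orbit_fun_apply act_mem)

text \<open>The factor \<open>u\<close> normalises the functional and selects a real part
  (\<open>u\<close> positive) or an imaginary part (a positive multiple of
  \<open>- \<i>\<close>).\<close>

lemma affine_functional_orbit:
  assumes \<xi>: "\<xi> \<in> K" and L: "complex_linear_on X L"
    and X: "\<And>h. h \<in> affine_continuous K \<Longrightarrow> orbit_fun \<xi> h \<in> X"
    and le: "\<And>h. h \<in> affine_continuous K \<Longrightarrow> cmod (u * L (orbit_fun \<xi> h)) \<le> norm (orbit_fun \<xi> h)"
  shows "affine_functional K (\<lambda>h. Re (u * L (orbit_fun \<xi> h)))"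
proof
  fix f g b assume f: "f \<in> affine_continuous K"
  have L_scale: "L (cscale c (orbit_fun \<xi> f)) = c * L (orbit_fun \<xi> f)" for c
    using L X[OF f] unfolding complex_linear_on_def by blast
  show "Re (u * L (orbit_fun \<xi> (\<lambda>x. c * f x))) = c * Re (u * L (orbit_fun \<xi> f))" for c
    by (simp add: orbit_fun_cmult f \<xi> L_scale algebra_simps)
  show "Re (u * L (orbit_fun \<xi> f)) \<le> b" if "\<And>x. x \<in> K \<Longrightarrow> \<bar>f x\<bar> \<le> b"
    using complex_Re_le_cmod le[OF f] norm_orbit_fun_le[OF f \<xi> that] by (meson order_trans)
  assume g: "g \<in> affine_continuous K"
  have "L (orbit_fun \<xi> f + orbit_fun \<xi> g) = L (orbit_fun \<xi> f) + L (orbit_fun \<xi> g)"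
    using L X[OF f] X[OF g] unfolding complex_linear_on_def by blast
  then show "Re (u * L (orbit_fun \<xi> (\<lambda>x. f x + g x)))
      = Re (u * L (orbit_fun \<xi> f)) + Re (u * L (orbit_fun \<xi> g))"
    by (simp add: orbit_fun_add f g \<xi> distrib_left)
qed (use K in auto)

text \<open>The definition of an action gives this only for restrictions of continuous linear functionals.
  It extends to \<open>h\<close> because the integral, as a functional on affine continuous functions, is
  evaluation at a point, which the linear functionals identify.\<close>

lemma cintegral_orbit_fun:
  assumes h: "h \<in> affine_continuous K" and \<xi>: "\<xi> \<in> K"
  shows "cintegral (conv (point_mass x) (point_mass y)) (apply_bcontfun (orbit_fun \<xi> h))
    = complex_of_real (h (act x (act y \<xi>)))"
proof -
  define \<mu> where "\<mu> = conv (point_mass x) (point_mass y)"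
  have \<mu>: "\<mu> \<in> prob_compact" unfolding \<mu>_def by (rule conv_prob)
  interpret N: prob_space "pos_variation (\<lambda>A. Re (\<mu> A))" by (rule cintegral_prob[OF \<mu>])
  define I where "I f = cintegral \<mu> (apply_bcontfun (orbit_fun \<xi> f))" for f
  interpret affine_functional K "\<lambda>f. Re (1 * I f)"
    unfolding I_def
    by (rule affine_functional_orbit[OF \<xi> complex_linear_on_cintegral[OF \<mu>]])
      (auto simp: cmod_cintegral_prob_le[OF \<mu>])
  have I: "I f = cintegral \<mu> (\<lambda>t. complex_of_real (f (act t \<xi>)))" if "f \<in> affine_continuous K" for f
    unfolding I_def by (simp add: orbit_fun_apply[OF that \<xi>, abs_def])
  \<comment> \<open>\<open>ex_eval\<close> only speaks of real parts; as the integrand is real,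
    nothing is lost.\<close>
  have real: "I f = complex_of_real (Re (I f))" if "f \<in> affine_continuous K" for f
    by (simp add: I[OF that] cintegral_prob(1)[OF \<mu>])
  have "Re (1 * I (\<lambda>x. 1)) = 1"
    by (simp add: I[OF affine_continuous_const] cintegral_prob(1)[OF \<mu>] N.prob_space)
  from ex_eval[OF this] obtain p
    where p: "p \<in> K" "\<And>h. h \<in> affine_continuous K \<Longrightarrow> Re (1 * I h) = h p" by metis
  have "p = act x (act y \<xi>)"
  proof (rule ccontr)
    assume "p \<noteq> act x (act y \<xi>)"
    then obtain \<phi> :: "'v \<Rightarrow> real"
      where \<phi>: "linear \<phi>" "continuous_on UNIV \<phi>" "\<phi> p \<noteq> \<phi> (act x (act y \<xi>))"
      by (rule separating_functional)
    have \<phi>A: "\<phi> \<in> affine_continuous K" using \<phi> by (intro affine_continuous_linear)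
    have "weak_integral_in K \<mu> (\<lambda>t. act t \<xi>) (act x (act y \<xi>))"
      using action \<xi> unfolding separately_continuous_action_def hypergroup_action_def \<mu>_def by blast
    then have "complex_of_real (\<phi> (act x (act y \<xi>))) = I \<phi>"
      using \<phi> unfolding weak_integral_in_def I[OF \<phi>A] by blast
    then have "Re (1 * I \<phi>) = \<phi> (act x (act y \<xi>))" by (metis Re_complex_of_real mult_1)
    then show False using p(2)[OF \<phi>A] \<phi>(3) by simp
  qed
  then show ?thesis using p(2)[OF h] real[OF h] by (simp add: I_def \<mu>_def)
qed

text \<open>At \<open>y\<close> the translate integrates the orbit function against the convolution
  of the point masses at \<open>invol x\<close> and \<open>y\<close>, which
  \<open>cintegral_orbit_fun\<close> evaluates.\<close>

lemma left_translate_orbit_fun: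
  assumes "h \<in> affine_continuous K" "\<xi> \<in> K"
  shows "left_translate conv invol x (orbit_fun \<xi> h) = orbit_fun \<xi> (\<lambda>k. h (act (invol x) k))"
  by (rule bcontfun_eqI)
    (simp add: left_translate_apply cintegral_orbit_fun orbit_fun_apply affine_continuous_act assms)

text \<open>By compactness of \<open>K\<close>, joint continuity is uniform in the point of
  \<open>K\<close>, hence uniform along the orbit of \<open>\<xi>\<close>. This is convergence in
  the supremum norm.\<close>

lemma orbit_fun_in_UCBr:
  assumes h: "h \<in> affine_continuous K" and \<xi>: "\<xi> \<in> K"
    and joint: "continuous_on (UNIV \<times> K) (\<lambda>(x, \<xi>). act x \<xi>)"
  shows "orbit_fun \<xi> h \<in> UCBr conv invol"
  unfolding UCBr_def mem_Collect_eq left_translate_orbit_fun[OF h \<xi>] continuous_on_def tendsto_iff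
proof (intro ballI allI impI)
  fix x0 :: 'h and \<epsilon> :: real assume "\<epsilon> > 0"
  have "continuous_on (UNIV \<times> K) (\<lambda>z. h (act (fst z) (snd z)))"
    using h act_mem joint unfolding affine_continuous_def case_prod_beta
    by (auto intro!: continuous_on_compose2[of K h])
  then obtain X0 where X0: "invol x0 \<in> X0" "open X0"
    and near: "\<forall>x\<in>X0 \<inter> UNIV. \<forall>k\<in>K. dist (h (act (fst (x, k)) (snd (x, k))))
      (h (act (fst (invol x0, k)) (snd (invol x0, k)))) \<le> \<epsilon> / 2"
    by (rule continuous_on_prod_compactE[OF _ K(1) UNIV_I half_gt_zero[OF \<open>\<epsilon> > 0\<close>]])
  have "dist (orbit_fun \<xi> (\<lambda>k. h (act (invol x) k))) (orbit_fun \<xi> (\<lambda>k. h (act (invol x0) k))) < \<epsilon>"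
    if "x \<in> invol -` X0" for x
  proof -
    \<comment> \<open>A pointwise bound controls the supremum only non-strictly, hence the margin
      \<open>\<epsilon> / 2\<close>.\<close>
    have "dist (orbit_fun \<xi> (\<lambda>k. h (act (invol x) k))) (orbit_fun \<xi> (\<lambda>k. h (act (invol x0) k))) \<le> \<epsilon> / 2"
      by (rule dist_bound) (use near that act_mem[OF \<xi>] in
        \<open>simp add: orbit_fun_apply affine_continuous_act h \<xi> dist_of_real\<close>)
    then show ?thesis using \<open>\<epsilon> > 0\<close> by simp
  qed
  moreover have "open (invol -` X0)" "x0 \<in> invol -` X0"
    using X0 by (auto intro: open_vimage continuous_invol)
  ultimately show "\<forall>\<^sub>F x in at x0. dist (orbit_fun \<xi> (\<lambda>k. h (act (invol x) k)))
      (orbit_fun \<xi> (\<lambda>k. h (act (invol x0) k))) < \<epsilon>"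
    unfolding eventually_at_topological by blast
qed

text \<open>A bounded functional on the orbit functions is a combination of two point evaluations, so weak
  continuity of the translates reduces to continuity of single orbits.\<close>

lemma orbit_fun_in_WUCBr:
  assumes h: "h \<in> affine_continuous K" and \<xi>: "\<xi> \<in> K"
  shows "orbit_fun \<xi> h \<in> WUCBr conv invol"
proof -
  let ?F = "\<lambda>x. orbit_fun \<xi> (\<lambda>k. h (act (invol x) k))"
  have cont: "continuous_on UNIV (\<lambda>x. L (?F x))"
    if L: "complex_linear_on UNIV L" "continuous_on UNIV L" for L
  proof -
    have "L (cscale 0 0) = 0 * L 0" using L(1) unfolding complex_linear_on_def by blast
    moreover have "cscale 0 0 = (0 :: 'h \<Rightarrow>\<^sub>C complex)"
      by (rule bcontfun_eqI) (simp add: cscale_apply)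
    ultimately have "L 0 = 0" by simp
    then obtain d where d: "d > 0" "\<And>f. norm f < d \<Longrightarrow> cmod (L f) < 1"
      using L(2)[unfolded continuous_on_iff, rule_format, of 0 1] by auto
    \<comment> \<open>Continuity at 0 controls \<open>L\<close> on the open ball of radius
      \<open>d\<close>; the closed ball of radius \<open>d / 2\<close> lies inside it.\<close>
    define C where "C = 1 / (d / 2)"
    have C: "C > 0" using d by (simp add: C_def)
    have bound: "cmod (L f) \<le> C * norm f" for f
      unfolding C_def
      by (rule complex_linear_on_bound[OF L(1)]) (use d in \<open>auto intro: less_imp_le\<close>)
    have part: "continuous_on UNIV (\<lambda>x. Re (u * L (?F x)))" if "cmod u = 1" for u
    proof -
      \<comment> \<open>Division by \<open>C\<close> makes the functional contractive, as the locale
        demands.\<close>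
      interpret affine_functional K "\<lambda>f. Re (u / of_real C * L (orbit_fun \<xi> f))"
        by (rule affine_functional_orbit[OF \<xi> L(1)])
          (use bound C that in \<open>auto simp: norm_mult norm_divide field_simps\<close>)
      obtain p q a where pq: "p \<in> K" "q \<in> K" and eq: "\<And>g. g \<in> affine_continuous K \<Longrightarrow>
          Re (u / of_real C * L (orbit_fun \<xi> g)) = a * g p - (1 - a) * g q"
        using ex_signed_eval by metis
      have "Re (u * L (?F x)) =
          C * (a * h (act (invol x) p) - (1 - a) * h (act (invol x) q))" for x
        unfolding eq[OF affine_continuous_act[OF h], symmetric] using C
        by (simp add: field_simps)
      then show ?thesis
        by (simp, intro continuous_intros
            continuous_on_compose2[OF continuous_affine_orbit[OF h] continuous_invol] pq) auto
    qed
    \<comment> \<open>The factors 1 and \<open>- \<i>\<close> recover the real and imaginary parts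
      of \<open>L\<close>.\<close>
    have "L (?F x) = complex_of_real (Re (1 * L (?F x))) + \<i> * complex_of_real (Re (- \<i> * L (?F x)))" for x
      by (simp add: complex_eq_iff)
    moreover have "continuous_on UNIV (\<lambda>x. complex_of_real (Re (1 * L (?F x)))
        + \<i> * complex_of_real (Re (- \<i> * L (?F x))))"
      by (intro continuous_intros part) auto
    ultimately show ?thesis by presburger
  qed
  have "continuous_map euclidean weak_topology ?F"
    unfolding weak_topology_def
  proof (rule continuous_on_generated_topo)
    fix W :: "('h \<Rightarrow>\<^sub>C complex) set"
    assume "W \<in> {L -` U | L U. complex_linear_on UNIV L \<and> continuous_on UNIV L \<and> open U}"
    then obtain L and U :: "complex set" where W: "W = L -` U"
      and L: "complex_linear_on UNIV L" "continuous_on UNIV L" "open U" by blast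
    have "open ((\<lambda>x. L (?F x)) -` U)" by (intro open_vimage cont L)
    then show "openin euclidean (?F -` W \<inter> topspace euclidean)" by (simp add: W vimage_def)
  next
    \<comment> \<open>The carrier of a generated topology is the union of its generators; the zero
      functional shows that it is everything.\<close>
    have "UNIV = (\<lambda>_. 0) -` (UNIV :: complex set)" "complex_linear_on UNIV (\<lambda>_. 0)"
      by (auto simp: complex_linear_on_def)
    then have "UNIV \<in> {L -` U | (L :: ('h \<Rightarrow>\<^sub>C complex) \<Rightarrow> complex) U.
        complex_linear_on UNIV L \<and> continuous_on UNIV L \<and> open U}"
      using open_UNIV continuous_on_const by blast
    then show "?F ` topspace euclidean \<subseteq> \<Union> {L -` U | (L :: ('h \<Rightarrow>\<^sub>C complex) \<Rightarrow> complex) U.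
        complex_linear_on UNIV L \<and> continuous_on UNIV L \<and> open U}" by blast
  qed
  then show ?thesis by (simp add: WUCBr_def left_translate_orbit_fun[OF h \<xi>])
qed

section \<open>From an invariant mean to a fixed point\<close>

theorem ex_fixed_point:
  assumes m: "left_invariant_mean conv invol X m"
    and X: "\<And>\<xi> h. \<xi> \<in> K \<Longrightarrow> h \<in> affine_continuous K \<Longrightarrow> orbit_fun \<xi> h \<in> X"
  shows "\<exists>\<xi>\<^sub>0\<in>K. \<forall>x. act x \<xi>\<^sub>0 = \<xi>\<^sub>0"
proof -
  obtain \<xi> where \<xi>: "\<xi> \<in> K" using K by blast
  have lin: "complex_linear_on X m"
    and sup: "(SUP f\<in>{f\<in>X. norm f \<le> 1}. ennreal (cmod (m f))) = 1"
    and one: "m (const_bcontfun 1) = 1"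
    and inv: "\<And>f x. f \<in> X \<Longrightarrow> m (left_translate conv invol x f) = m f"
    using m unfolding left_invariant_mean_def by blast+
  have unit: "cmod (m f) \<le> 1" if "f \<in> X" "norm f \<le> 1" for f
  proof -
    have "ennreal (cmod (m f)) \<le> 1" unfolding sup[symmetric] by (rule SUP_upper) (use that in simp)
    then show ?thesis by simp
  qed
  interpret affine_functional K "\<lambda>h. Re (1 * m (orbit_fun \<xi> h))"
  proof (rule affine_functional_orbit[OF \<xi> lin X[OF \<xi>]])
    fix h assume h: "h \<in> affine_continuous K"
    have "cmod (m (orbit_fun \<xi> h)) \<le> 1 / 1 * norm (orbit_fun \<xi> h)"
      by (rule complex_linear_on_bound[OF lin X[OF \<xi> h]])
        (auto simp: unit orbit_fun_cmult[OF h \<xi>, symmetric] X \<xi> affine_continuous_cmult h)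
    then show "cmod (1 * m (orbit_fun \<xi> h)) \<le> norm (orbit_fun \<xi> h)" by simp
  qed
  have "orbit_fun \<xi> (\<lambda>x. 1) = const_bcontfun 1"
    by (rule bcontfun_eqI) (simp add: orbit_fun_apply[OF affine_continuous_const \<xi>])
  then have "Re (1 * m (orbit_fun \<xi> (\<lambda>x. 1))) = 1" by (simp add: one)
  from ex_eval[OF this] obtain p
    where p: "p \<in> K" "\<And>h. h \<in> affine_continuous K \<Longrightarrow> Re (1 * m (orbit_fun \<xi> h)) = h p" by metis
  have "act x p = p" for x
  proof (rule ccontr)
    assume "act x p \<noteq> p"
    then obtain \<phi> :: "'v \<Rightarrow> real"
      where \<phi>: "linear \<phi>" "continuous_on UNIV \<phi>" "\<phi> (act x p) \<noteq> \<phi> p"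
      by (rule separating_functional)
    have \<phi>A: "\<phi> \<in> affine_continuous K" using \<phi> by (intro affine_continuous_linear)
    \<comment> \<open>Translation involves \<open>invol\<close>, so translating by
      \<open>invol x\<close> produces the action of \<open>x\<close> itself.\<close>
    have "orbit_fun \<xi> (\<lambda>k. \<phi> (act x k)) = left_translate conv invol (invol x) (orbit_fun \<xi> \<phi>)"
      by (simp add: left_translate_orbit_fun[OF \<phi>A \<xi>] invol_invol)
    then have "m (orbit_fun \<xi> (\<lambda>k. \<phi> (act x k))) = m (orbit_fun \<xi> \<phi>)"
      by (simp add: inv X \<phi>A \<xi>)
    then show False using p(2)[OF \<phi>A] p(2)[OF affine_continuous_act[OF \<phi>A, of x]] \<phi>(3) by simp
  qed
  then show ?thesis using p by blast
qed

end

lemma jointly_imp_separately_continuous_action: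
  assumes "jointly_continuous_action conv e K act"
  shows "separately_continuous_action conv e K act"
proof -
  have act: "hypergroup_action conv e K act"
    and joint: "continuous_on (UNIV \<times> K) (\<lambda>(x, \<xi>). act x \<xi>)"
    using assms by (auto simp: jointly_continuous_action_def)
  have "continuous_on K (act x)" for x
    using continuous_on_compose2[OF joint, of K "\<lambda>\<xi>. (x, \<xi>)"]
    by (simp add: continuous_on_Pair image_subset_iff)
  moreover have "continuous_on UNIV (\<lambda>x. act x \<xi>)" if "\<xi> \<in> K" for \<xi>
    using continuous_on_compose2[OF joint, of UNIV "\<lambda>x. (x, \<xi>)"] that
    by (simp add: continuous_on_Pair image_subset_iff)
  ultimately show ?thesis using act by (simp add: separately_continuous_action_def)
qed

theorem theorem3p2:
  fixes conv :: "('h::t2_space) cmeasure \<Rightarrow> 'h cmeasure \<Rightarrow> 'h cmeasure"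
    and e :: 'h
    and invol :: "'h \<Rightarrow> 'h"
  assumes "hypergroup conv e invol"
  shows
    "((\<exists>m. left_invariant_mean conv invol (UCBr conv invol) m) \<longrightarrow>
        (\<forall>(K :: 'v::hausdorff_lcs set) act.
           K \<noteq> {} \<longrightarrow> compact K \<longrightarrow> convex K \<longrightarrow>
           jointly_continuous_action conv e K act \<longrightarrow> affine_action K act \<longrightarrow>
           (\<exists>\<xi>\<^sub>0\<in>K. \<forall>x. act x \<xi>\<^sub>0 = \<xi>\<^sub>0))) \<and>
     ((\<exists>m. left_invariant_mean conv invol (WUCBr conv invol) m) \<longrightarrow>
        (\<forall>(K :: 'v::hausdorff_lcs set) act.
           K \<noteq> {} \<longrightarrow> compact K \<longrightarrow> convex K \<longrightarrow>
           separately_continuous_action conv e K act \<longrightarrow> affine_action K act \<longrightarrow>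
           (\<exists>\<xi>\<^sub>0\<in>K. \<forall>x. act x \<xi>\<^sub>0 = \<xi>\<^sub>0)))"
proof (intro conjI impI allI; elim exE)
  fix K :: "'v set" and act :: "'h \<Rightarrow> 'v \<Rightarrow> 'v" and m
  assume K: "K \<noteq> {}" "compact K" "convex K" and act: "affine_action K act"
  {
    assume m: "left_invariant_mean conv invol (UCBr conv invol) m"
      and joint: "jointly_continuous_action conv e K act"
    interpret affine_hypergroup_action conv e invol K act
      using assms K act jointly_imp_separately_continuous_action[OF joint]
      by (intro affine_hypergroup_action.intro affine_hypergroup_action_axioms.intro)
    show "\<exists>\<xi>\<^sub>0\<in>K. \<forall>x. act x \<xi>\<^sub>0 = \<xi>\<^sub>0"
      using ex_fixed_point[OF m orbit_fun_in_UCBr] joint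
      by (simp add: jointly_continuous_action_def)
  next
    assume m: "left_invariant_mean conv invol (WUCBr conv invol) m"
      and sep: "separately_continuous_action conv e K act"
    interpret affine_hypergroup_action conv e invol K act
      using assms K act sep
      by (intro affine_hypergroup_action.intro affine_hypergroup_action_axioms.intro)
    show "\<exists>\<xi>\<^sub>0\<in>K. \<forall>x. act x \<xi>\<^sub>0 = \<xi>\<^sub>0"
      using ex_fixed_point[OF m orbit_fun_in_WUCBr] .
  }
qed

end
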